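(* Let $\beta>0$ and $J,h\in\mathbb R$. 1. (Unique limit measure) For every boundary condition $\eta\in\Omega=\{-1,1\}^{\mathbb N}$, the finite-volume measures $\mu_N^\eta$ converge weakly, as $N\to\infty$, to a probability measure $\mu_\infty^{M}$ on $\Omega$ that does not depend on $\eta$ (the multiplicative Ising measure). Consequently, $\mu^M_\infty$ is the unique infinite-volume Gibbs measure on $\Omega$ for the potential $U$ given by $U(\{i\},\sigma)=-\beta h\sigma_i$, $U(\{i,2i\},\sigma)=-J\beta\sigma_i\sigma_{2i}$ ($i\in\mathbb N$), and $U(A,\sigma)=0$ for all other finite $A\subset\mathbb N$. 2. (Independent Ising layers) Under $\mu^M_\infty$, the processes $\tau^r=(\tau^r_i)_{i\in\mathbb N_0}$, $r\in\mathbb N$ odd, defined by $\tau^r_i=\sigma_{r2^i}$, are independent, and each is distributed according to the standard Ising measure $\mu^{\mathrm{Ising}}_\infty$ on $\{-1,1\}^{\mathbb N_0}$ with free boundary condition on the left. 3. (Multiplication invariance) If $h=0$, then $\mu^M_\infty$ is multiplication invariant, i.e. for all $i\in\mathbb N$, $\sigma$ and $T_i\sigma$ have the same distribution under $\mu^M_\infty$.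
   Context: $\mathbb N=\{1,2,\ldots\}$, $\mathbb N_0=\mathbb N\cup\{0\}$. $\Omega=\{-1,1\}^{\mathbb N}$. The multiplicative shift is $(T_i\sigma)_j=\sigma_{ij}$ for $i,j\in\mathbb N$. Finite-volume measures: for $N\in\mathbb N$ and $\eta\in\Omega$, $\mu_N^\eta$ is the probability measure on $\{-1,1\}^{[1,2N]}$ (where $[1,2N]=\{1,\ldots,2N\}$) with $$\mu_N^\eta(\sigma_{[1,2N]})=\frac{e^{-H_N^\eta(\sigma_{[1,2N]})}}{Z_N^\eta},\qquad H_N^\eta(\sigma_{[1,2N]})=-\beta\Big(\sum_{i=1}^N J\sigma_i\sigma_{2i}+\sum_{i=1}^{2N}h\sigma_i+\sum_{i=N+1}^{2N}J\sigma_i\eta_{2i}\Big),$$ with $Z_N^\eta$ the normalizing constant. Weak convergence means convergence of the probabilities of all cylinder events. A Gibbs measure for a potential $U$ is a probability measure on $\Omega$ such that for every finite $\Lambda\subset\mathbb N$ the conditional distribution of $\sigma_\Lambda$ given $\sigma_{\Lambda^c}=\eta_{\Lambda^c}$ is proportional to $\exp\big(-\sum_{A\cap\Lambda\ne\emptyset}U(A,\sigma_\Lambda\eta_{\Lambda^c})\big)$. The standard Ising measure $\mu^{\mathrm{Ising}}_\infty$ is the weak limit as $N\to\infty$ (which exists and does not depend on the sign $\pm$) of the probability measures on $\{-1,1\}^{[0,N]}$ with weights proportional to $\exp\big(\beta(\sum_{i=0}^{N-1}J\sigma_i\sigma_{i+1}+\sum_{i=0}^N h\sigma_i\pm\sigma_N)\big)$.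 *)

theory Defs
  imports "HOL-Probability.Probability"
begin

text \<open>The index set \<open>\<nat> = {1, 2, \<dots>}\<close> is rendered as \<open>{1..}\<close> and \<open>\<nat>\<^sub>0\<close> as \<open>UNIV\<close>,
  both of type \<^typ>\<open>nat set\<close>. A spin configuration on \<open>I\<close> is an extensional function: it is
  \<^const>\<open>undefined\<close> outside \<open>I\<close>.\<close>

definition spin_configs :: "nat set \<Rightarrow> (nat \<Rightarrow> real) set" where
  "spin_configs I = (\<Pi>\<^sub>E i\<in>I. {-1, 1})"

definition spin_algebra :: "nat set \<Rightarrow> (nat \<Rightarrow> real) measure" where
  "spin_algebra I = (\<Pi>\<^sub>M i\<in>I. count_space {-1, 1})"

definition mult_shift :: "nat \<Rightarrow> (nat \<Rightarrow> real) \<Rightarrow> (nat \<Rightarrow> real)" where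
  "mult_shift i \<sigma> = (\<lambda>j\<in>{1..}. \<sigma> (i * j))"

definition layer :: "nat \<Rightarrow> (nat \<Rightarrow> real) \<Rightarrow> (nat \<Rightarrow> real)" where
  "layer r \<sigma> = (\<lambda>i. \<sigma> (r * 2 ^ i))"


definition boltzmann_measure ::
  "nat set \<Rightarrow> ((nat \<Rightarrow> real) \<Rightarrow> real) \<Rightarrow> (nat \<Rightarrow> real) measure" where
  "boltzmann_measure I H =
     point_measure (spin_configs I)
       (\<lambda>\<sigma>. ennreal (exp (- H \<sigma>) / (\<Sum>\<sigma>'\<in>spin_configs I. exp (- H \<sigma>'))))"

definition mult_hamiltonian ::
  "real \<Rightarrow> real \<Rightarrow> real \<Rightarrow> nat \<Rightarrow> (nat \<Rightarrow> real) \<Rightarrow> (nat \<Rightarrow> real) \<Rightarrow> real" where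
  "mult_hamiltonian \<beta> J h N \<eta> \<sigma> =
     - \<beta> * ((\<Sum>i=1..N. J * \<sigma> i * \<sigma> (2 * i)) + (\<Sum>i=1..2*N. h * \<sigma> i)
            + (\<Sum>i=N+1..2*N. J * \<sigma> i * \<eta> (2 * i)))"

definition mult_ising_finite ::
  "real \<Rightarrow> real \<Rightarrow> real \<Rightarrow> nat \<Rightarrow> (nat \<Rightarrow> real) \<Rightarrow> (nat \<Rightarrow> real) measure" where
  "mult_ising_finite \<beta> J h N \<eta> = boltzmann_measure {1..2*N} (mult_hamiltonian \<beta> J h N \<eta>)"

text \<open>The parameter \<open>s\<close> is the sign of the right boundary spin.\<close>

definition ising_finite ::
  "real \<Rightarrow> real \<Rightarrow> real \<Rightarrow> real \<Rightarrow> nat \<Rightarrow> (nat \<Rightarrow> real) measure" where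
  "ising_finite \<beta> J h s N = boltzmann_measure {0..N}
     (\<lambda>\<sigma>. - \<beta> * ((\<Sum>i<N. J * \<sigma> i * \<sigma> (i + 1)) + (\<Sum>i=0..N. h * \<sigma> i) + s * \<sigma> N))"


text \<open>The measures \<open>M n\<close> live on configurations of an increasing sequence of finite volumes
  exhausting \<open>I\<close>, so the event on \<open>\<Lambda>\<close> is the intended one as soon as the volume contains \<open>\<Lambda>\<close>;
  the finitely many earlier terms do not affect the limit.\<close>

definition cylinder_limit ::
  "nat set \<Rightarrow> (nat \<Rightarrow> (nat \<Rightarrow> real) measure) \<Rightarrow> (nat \<Rightarrow> real) measure \<Rightarrow> bool" where
  "cylinder_limit I M \<mu> \<longleftrightarrow>
     prob_space \<mu> \<and> sets \<mu> = sets (spin_algebra I) \<and>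
     (\<forall>\<Lambda> A. finite \<Lambda> \<and> \<Lambda> \<subseteq> I \<and> A \<subseteq> spin_configs \<Lambda> \<longrightarrow>
        (\<lambda>n. measure (M n) {\<sigma> \<in> space (M n). restrict \<sigma> \<Lambda> \<in> A})
          \<longlonglongrightarrow> measure \<mu> {\<sigma> \<in> space \<mu>. restrict \<sigma> \<Lambda> \<in> A})"

definition is_standard_ising ::
  "real \<Rightarrow> real \<Rightarrow> real \<Rightarrow> (nat \<Rightarrow> real) measure \<Rightarrow> bool" where
  "is_standard_ising \<beta> J h \<nu> \<longleftrightarrow>
     (\<forall>s\<in>{-1, 1}. cylinder_limit UNIV (ising_finite \<beta> J h s) \<nu>)"


text \<open>The energy of \<open>\<Lambda>\<close> is an unconditional sum over all finite \<open>A\<close> meeting \<open>\<Lambda>\<close>, which is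
  meaningful only for summable potentials (\<^const>\<open>infsum\<close> is \<open>0\<close> otherwise). For \<open>mult_potential\<close>
  below only finitely many summands are nonzero.\<close>

definition gibbs_energy ::
  "(nat set \<Rightarrow> (nat \<Rightarrow> real) \<Rightarrow> real) \<Rightarrow> nat set \<Rightarrow> (nat \<Rightarrow> real) \<Rightarrow> (nat \<Rightarrow> real) \<Rightarrow> real" where
  "gibbs_energy U \<Lambda> \<omega> \<eta> =
     (\<Sum>\<^sub>\<infinity>A\<in>{A. finite A \<and> A \<subseteq> {1..} \<and> A \<inter> \<Lambda> \<noteq> {}}. U A (merge \<Lambda> ({1..} - \<Lambda>) (\<omega>, \<eta>)))"

definition gibbs_kernel ::
  "(nat set \<Rightarrow> (nat \<Rightarrow> real) \<Rightarrow> real) \<Rightarrow> nat set \<Rightarrow> (nat \<Rightarrow> real) \<Rightarrow> (nat \<Rightarrow> real) \<Rightarrow> real" where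
  "gibbs_kernel U \<Lambda> \<omega> \<eta> =
     exp (- gibbs_energy U \<Lambda> \<omega> \<eta>) / (\<Sum>\<omega>'\<in>spin_configs \<Lambda>. exp (- gibbs_energy U \<Lambda> \<omega>' \<eta>))"

definition outside_algebra :: "nat set \<Rightarrow> (nat \<Rightarrow> real) measure" where
  "outside_algebra \<Lambda> =
     vimage_algebra (space (spin_algebra {1..})) (\<lambda>\<sigma>. restrict \<sigma> ({1..} - \<Lambda>))
       (spin_algebra ({1..} - \<Lambda>))"

text \<open>The conditional distribution of \<open>\<sigma>\<^sub>\<Lambda>\<close> given the spins outside \<open>\<Lambda>\<close> is prescribed through
  the conditional probabilities of its atoms, as \<open>\<sigma>\<^sub>\<Lambda>\<close> takes finitely many values.\<close>

definition is_gibbs_measure ::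
  "(nat set \<Rightarrow> (nat \<Rightarrow> real) \<Rightarrow> real) \<Rightarrow> (nat \<Rightarrow> real) measure \<Rightarrow> bool" where
  "is_gibbs_measure U \<mu> \<longleftrightarrow>
     prob_space \<mu> \<and> sets \<mu> = sets (spin_algebra {1..}) \<and>
     (\<forall>\<Lambda> \<omega>. finite \<Lambda> \<and> \<Lambda> \<subseteq> {1..} \<and> \<omega> \<in> spin_configs \<Lambda> \<longrightarrow>
        (AE \<eta> in \<mu>. real_cond_exp \<mu> (outside_algebra \<Lambda>)
             (indicator {\<sigma> \<in> space \<mu>. restrict \<sigma> \<Lambda> = \<omega>}) \<eta> = gibbs_kernel U \<Lambda> \<omega> \<eta>))"

definition mult_potential ::
  "real \<Rightarrow> real \<Rightarrow> real \<Rightarrow> nat set \<Rightarrow> (nat \<Rightarrow> real) \<Rightarrow> real" where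
  "mult_potential \<beta> J h A \<sigma> =
     (let i = Min A in
      if A = {i} then - \<beta> * h * \<sigma> i
      else if A = {i, 2 * i} then - J * \<beta> * \<sigma> i * \<sigma> (2 * i)
      else 0)"

lemma mult_potential_singleton: "mult_potential \<beta> J h {i} \<sigma> = - \<beta> * h * \<sigma> i"
  by (simp add: mult_potential_def)

lemma mult_potential_pair:
  "i \<ge> 1 \<Longrightarrow> mult_potential \<beta> J h {i, 2 * i} \<sigma> = - J * \<beta> * \<sigma> i * \<sigma> (2 * i)"
  by (simp add: mult_potential_def)

lemma mult_potential_other:
  "A \<subseteq> {1..} \<Longrightarrow> (\<And>i. i \<ge> 1 \<Longrightarrow> A \<noteq> {i} \<and> A \<noteq> {i, 2 * i}) \<Longrightarrow> mult_potential \<beta> J h A \<sigma> = 0"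
  unfolding mult_potential_def Let_def
  by (metis atLeast_iff insert_subset)

end

theory Submission
  imports Defs
begin

text \<open>The interaction graph is a disjoint union of half-lines, one for each odd number, so the
  model splits into independent Ising chains. With the Perron eigenvector of the transfer matrix as
  a boundary weight, the finite-volume weights become those of a Markov chain along each half-line.
  The candidate limit runs this chain with independent noise at every site; disjoint half-lines use
  disjoint noise, which gives the independence of the layers, and for zero field the chain is
  stationary, which gives the invariance. Any other boundary condition is a positive bounded boundary
  weight; integrating out sites applies the stochastic kernel repeatedly, which contracts the
  oscillation of the weight geometrically, so the weight cancels in the limit. A Gibbs measure is for
  every volume a mixture of the finite-volume measures, hence equals the limit.\<close>

subsection \<open>Spin configurations\<close>

text \<open>The obstacle is that the boundary of \<open>{1..2 * N}\<close> has N sites, so a bound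
  on the weight per site gives no uniform comparison of two boundary conditions. A fixed window,
  however, is left by only finitely many half-lines, and everything beyond it acts on the window
  through one effective field per half-line. Only ratios of these fields matter, and each tends to 1
  because its oscillation vanishes while the field stays bounded below. The eigenvector makes the
  weights of growing volumes consistent: conjugating the transfer matrix by it gives a stochastic
  matrix, so summing over a last child costs no factor. Realising the limit as an image of a product
  measure supplies a measure on the infinite space together with its cylinder probabilities. Each
  noise value lists the response to both possible parent spins, so the noises are independent though
  the spins are not. Uniqueness rests on convergence at every single boundary condition:
  probabilities are bounded by 1, so dominated convergence applies under any Gibbs measure.\<close>

lemma finite_spin_configs: "finite I \<Longrightarrow> finite (spin_configs I)"
  by (simp add: spin_configs_def finite_PiE)

lemma spin_configs_nonempty: "spin_configs I \<noteq> {}"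
  by (simp add: spin_configs_def PiE_eq_empty_iff)

lemma spin_configsD: "\<sigma> \<in> spin_configs I \<Longrightarrow> i \<in> I \<Longrightarrow> \<sigma> i \<in> {-1, 1}"
  by (auto simp: spin_configs_def)

lemma restrict_spin_configs: "\<sigma> \<in> spin_configs I \<Longrightarrow> \<Lambda> \<subseteq> I \<Longrightarrow> restrict \<sigma> \<Lambda> \<in> spin_configs \<Lambda>"
  by (auto simp: spin_configs_def)

lemma restrict_spin_configs_eq: "\<sigma> \<in> spin_configs I \<Longrightarrow> restrict \<sigma> I = \<sigma>"
  by (simp add: spin_configs_def PiE_restrict)

lemma space_spin_algebra: "space (spin_algebra I) = spin_configs I"
  by (simp add: spin_algebra_def spin_configs_def space_PiM)

lemma measurable_spin: "i \<in> I \<Longrightarrow> (\<lambda>\<sigma>. \<sigma> i) \<in> measurable (spin_algebra I) (count_space {-1, 1})"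
  unfolding spin_algebra_def by simp

lemma measurable_spin_borel: "i \<in> I \<Longrightarrow> (\<lambda>\<sigma>. \<sigma> i) \<in> borel_measurable (spin_algebra I)"
  using measurable_compose[OF measurable_spin, of i I "\<lambda>x. x" borel] by simp

lemma measurable_restrict_spin:
  "\<Lambda> \<subseteq> I \<Longrightarrow> (\<lambda>\<sigma>. restrict \<sigma> \<Lambda>) \<in> measurable (spin_algebra I) (spin_algebra \<Lambda>)"
  unfolding spin_algebra_def by (rule measurable_restrict_subset)

text \<open>Singletons are finite rectangles. This identifies the power-set algebra of a Boltzmann
  measure with a spin algebra, so the cylinder lemmas apply to finite volumes as well.\<close>

lemma sets_spin_algebra_finite:
  assumes "finite \<Lambda>"
  shows "sets (spin_algebra \<Lambda>) = Pow (spin_configs \<Lambda>)"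
proof -
  have "{\<zeta>} \<in> sets (spin_algebra \<Lambda>)" if "\<zeta> \<in> spin_configs \<Lambda>" for \<zeta>
  proof -
    have "{\<zeta>} = (\<Pi>\<^sub>E i\<in>\<Lambda>. {\<zeta> i})"
      using that unfolding spin_configs_def
      by (auto simp: PiE_iff extensional_def fun_eq_iff) metis
    moreover have "\<dots> \<in> sets (spin_algebra \<Lambda>)"
      unfolding spin_algebra_def using assms that
      by (intro sets_PiM_I_finite) (auto dest: spin_configsD)
    ultimately show ?thesis by simp
  qed
  then have "A \<in> sets (spin_algebra \<Lambda>)" if "A \<subseteq> spin_configs \<Lambda>" for A
    using that finite_subset[OF that finite_spin_configs[OF assms]]
    by (subst UN_singleton[symmetric]) (intro sets.finite_UN, auto)
  moreover have "A \<subseteq> spin_configs \<Lambda>" if "A \<in> sets (spin_algebra \<Lambda>)" for A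
    using sets.sets_into_space[OF that] by (simp add: space_spin_algebra)
  ultimately show ?thesis by blast
qed

lemma cylinder_measurable:
  assumes "sets M = sets (spin_algebra I)" "finite \<Lambda>" "\<Lambda> \<subseteq> I" "A \<subseteq> spin_configs \<Lambda>"
  shows "{\<sigma> \<in> space M. restrict \<sigma> \<Lambda> \<in> A} \<in> sets M"
proof -
  have "(\<lambda>\<sigma>. restrict \<sigma> \<Lambda>) -` A \<inter> space (spin_algebra I) \<in> sets (spin_algebra I)"
    using assms by (intro measurable_sets[OF measurable_restrict_spin])
      (auto simp: sets_spin_algebra_finite)
  then show ?thesis
    using assms(1) sets_eq_imp_space_eq[OF assms(1)] by (simp add: vimage_def Int_def conj_commute)
qed

lemma cylinder_measurable_singleton:
  assumes "sets M = sets (spin_algebra I)" "finite \<Lambda>" "\<Lambda> \<subseteq> I" "\<zeta> \<in> spin_configs \<Lambda>"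
  shows "{\<sigma> \<in> space M. restrict \<sigma> \<Lambda> = \<zeta>} \<in> sets M"
  using cylinder_measurable[of M I \<Lambda> "{\<zeta>}"] assms by simp

lemma emeasure_cylinder_eq_sum:
  assumes M: "sets M = sets (spin_algebra I)"
    and V: "finite V" "V \<subseteq> I" "\<Lambda> \<subseteq> V" and A: "A \<subseteq> spin_configs \<Lambda>"
  shows "emeasure M {\<sigma> \<in> space M. restrict \<sigma> \<Lambda> \<in> A} =
    (\<Sum>\<zeta>\<in>{\<zeta>\<in>spin_configs V. restrict \<zeta> \<Lambda> \<in> A}. emeasure M {\<sigma> \<in> space M. restrict \<sigma> V = \<zeta>})"
proof -
  have sp: "space M = spin_configs I"
    using sets_eq_imp_space_eq[OF M] by (simp add: space_spin_algebra)
  have "{\<sigma> \<in> space M. restrict \<sigma> \<Lambda> \<in> A} =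
      (\<Union>\<zeta>\<in>{\<zeta>\<in>spin_configs V. restrict \<zeta> \<Lambda> \<in> A}. {\<sigma> \<in> space M. restrict \<sigma> V = \<zeta>})"
    using V restrict_spin_configs[of _ I V] by (auto simp: sp Int_absorb1)
  also have "emeasure M \<dots> =
      (\<Sum>\<zeta>\<in>{\<zeta>\<in>spin_configs V. restrict \<zeta> \<Lambda> \<in> A}. emeasure M {\<sigma> \<in> space M. restrict \<sigma> V = \<zeta>})"
    using V finite_spin_configs[of V] cylinder_measurable_singleton[OF M V(1,2)]
    by (intro sum_emeasure[symmetric]) (auto simp: disjoint_family_on_def)
  finally show ?thesis .
qed

lemma measure_cylinder_eq_sum:
  assumes "finite_measure M" and M: "sets M = sets (spin_algebra I)"
    and V: "finite V" "V \<subseteq> I" "\<Lambda> \<subseteq> V" and A: "A \<subseteq> spin_configs \<Lambda>"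
  shows "measure M {\<sigma> \<in> space M. restrict \<sigma> \<Lambda> \<in> A} =
    (\<Sum>\<zeta>\<in>{\<zeta>\<in>spin_configs V. restrict \<zeta> \<Lambda> \<in> A}. measure M {\<sigma> \<in> space M. restrict \<sigma> V = \<zeta>})"
proof -
  interpret finite_measure M by fact
  have "ennreal (measure M {\<sigma> \<in> space M. restrict \<sigma> \<Lambda> \<in> A}) =
    ennreal (\<Sum>\<zeta>\<in>{\<zeta>\<in>spin_configs V. restrict \<zeta> \<Lambda> \<in> A}. measure M {\<sigma> \<in> space M. restrict \<sigma> V = \<zeta>})"
    using emeasure_cylinder_eq_sum[OF M V A] by (simp add: emeasure_eq_measure sum_nonneg)
  then show ?thesis by (simp add: sum_nonneg)
qed

text \<open>Cylinders over finite sets generate the algebra, and initial segments are cofinal among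
  finite sets. The threshold \<open>n0\<close> allows the atoms to be compared only in volumes that
  are large enough.\<close>

lemma spin_measure_eqI:
  assumes P: "sets P = sets (spin_algebra I)" and Q: "sets Q = sets (spin_algebra I)"
    and "finite_measure P"
    and eq: "\<And>n \<zeta>. n \<ge> n0 \<Longrightarrow> \<zeta> \<in> spin_configs (I \<inter> {..<n}) \<Longrightarrow>
      emeasure P {\<sigma> \<in> space P. restrict \<sigma> (I \<inter> {..<n}) = \<zeta>} =
      emeasure Q {\<sigma> \<in> space Q. restrict \<sigma> (I \<inter> {..<n}) = \<zeta>}"
  shows "P = Q"
proof (rule measure_eqI_PiM_infinite)
  show "sets P = sets (\<Pi>\<^sub>M i\<in>I. count_space {-1, 1})" "sets Q = sets (\<Pi>\<^sub>M i\<in>I. count_space {-1, 1})"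
    using P Q by (simp_all add: spin_algebra_def)
  fix A :: "nat \<Rightarrow> real set" and \<Lambda> :: "nat set"
  assume \<Lambda>: "finite \<Lambda>" "\<Lambda> \<subseteq> I" and A: "\<And>i. i \<in> \<Lambda> \<Longrightarrow> A i \<in> sets (count_space {-1, 1})"
  have spP: "space P = spin_configs I" and spQ: "space Q = spin_configs I"
    using sets_eq_imp_space_eq[OF P] sets_eq_imp_space_eq[OF Q] by (simp_all add: space_spin_algebra)
  let ?emb = "prod_emb I (\<lambda>i. count_space {-1, 1}) \<Lambda> (Pi\<^sub>E \<Lambda> A)"
  have emb: "?emb = {\<sigma> \<in> spin_configs I. restrict \<sigma> \<Lambda> \<in> Pi\<^sub>E \<Lambda> A}"
    by (auto simp: prod_emb_def spin_configs_def)
  have A': "Pi\<^sub>E \<Lambda> A \<subseteq> spin_configs \<Lambda>"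
    unfolding spin_configs_def using A by (intro PiE_mono) auto
  \<comment> \<open>A segment past both \<Lambda> and the threshold; the cylinder splits into atoms
    of this segment.\<close>
  obtain n1 where n1: "\<Lambda> \<subseteq> {..<n1}"
    using \<Lambda>(1) finite_nat_bounded by blast
  define n where "n = max n0 n1"
  let ?V = "I \<inter> {..<n}"
  have V: "finite ?V" "?V \<subseteq> I" "\<Lambda> \<subseteq> ?V"
    using n1 \<Lambda> by (auto simp: n_def)
  show "emeasure P ?emb = emeasure Q ?emb"
    using emeasure_cylinder_eq_sum[OF P V A'] emeasure_cylinder_eq_sum[OF Q V A'] eq[of n]
    by (simp add: emb spP spQ n_def)
qed (fact assms)

lemma sum_spin_configs_insert:
  assumes "x \<notin> I"
  shows "(\<Sum>\<omega>\<in>spin_configs (insert x I). F \<omega>) =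
    (\<Sum>\<zeta>\<in>spin_configs I. (F (\<zeta>(x := 1)) + F (\<zeta>(x := -1)) :: real))"
proof -
  have inj: "inj_on (\<lambda>(y, g). g(x := y)) ({-1, 1} \<times> spin_configs I)"
    unfolding spin_configs_def using inj_combinator[OF assms, of "\<lambda>_. {-1, 1}"] by simp
  have "spin_configs (insert x I) = (\<lambda>(y, g). g(x := y)) ` ({-1, 1} \<times> spin_configs I)"
    unfolding spin_configs_def by (subst PiE_insert_eq) simp
  then have "(\<Sum>\<omega>\<in>spin_configs (insert x I). F \<omega>) =
      (\<Sum>(y, \<zeta>)\<in>{-1, 1} \<times> spin_configs I. F (\<zeta>(x := y)))"
    by (simp only: sum.reindex[OF inj]) (simp add: case_prod_unfold)
  also have "\<dots> = (\<Sum>y\<in>{-1, 1}. \<Sum>\<zeta>\<in>spin_configs I. F (\<zeta>(x := y)))"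
    by (simp add: sum.cartesian_product)
  finally show ?thesis
    by (simp add: sum.distrib add.commute)
qed

lemma
  assumes "finite I"
  shows space_boltzmann_measure: "space (boltzmann_measure I H) = spin_configs I"
    and sets_boltzmann_measure: "sets (boltzmann_measure I H) = Pow (spin_configs I)"
    and measure_boltzmann_measure: "A \<subseteq> spin_configs I \<Longrightarrow>
      measure (boltzmann_measure I H) A =
        (\<Sum>\<sigma>\<in>A. exp (- H \<sigma>)) / (\<Sum>\<sigma>\<in>spin_configs I. exp (- H \<sigma>))"
    and prob_space_boltzmann_measure: "prob_space (boltzmann_measure I H)"
proof -
  let ?Z = "\<Sum>\<sigma>\<in>spin_configs I. exp (- H \<sigma>)"
  have Z: "?Z > 0"
    using assms spin_configs_nonempty[of I] by (intro sum_pos finite_spin_configs) auto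
  show "space (boltzmann_measure I H) = spin_configs I"
    "sets (boltzmann_measure I H) = Pow (spin_configs I)"
    by (simp_all add: boltzmann_measure_def space_point_measure sets_point_measure)
  have em: "emeasure (boltzmann_measure I H) A = ennreal ((\<Sum>\<sigma>\<in>A. exp (- H \<sigma>)) / ?Z)"
    if "A \<subseteq> spin_configs I" for A
    unfolding boltzmann_measure_def using Z that
    by (subst emeasure_point_measure_finite[OF finite_spin_configs[OF assms]])
      (auto simp: sum_divide_distrib)
  then show "A \<subseteq> spin_configs I \<Longrightarrow>
      measure (boltzmann_measure I H) A = (\<Sum>\<sigma>\<in>A. exp (- H \<sigma>)) / ?Z"
    using Z by (intro measure_eq_emeasure_eq_ennreal) (auto intro!: divide_nonneg_pos sum_nonneg)
  show "prob_space (boltzmann_measure I H)"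
    using em[of "spin_configs I"] Z
    by (intro prob_spaceI) (simp add: boltzmann_measure_def space_point_measure)
qed

subsection \<open>Markov kernels and branching noise\<close>

text \<open>The inverse temperature is absorbed into \<open>J\<close> and \<open>h\<close>; \<open>(t, 1)\<close> is the Perron eigenvector, with
  eigenvalue \<open>lam\<close>, of the transfer matrix \<open>exp (J * s * b + h * b)\<close> on spins \<open>s, b\<close>.\<close>

locale ising_kernel =
  fixes J h t lam :: real
  assumes t_pos: "t > 0" and lam_pos: "lam > 0"
    and eigen_plus: "exp (J + h) * t + exp (- J - h) = lam * t"
    and eigen_minus: "exp (- J + h) * t + exp (J - h) = lam"
begin

definition eigvec :: "real \<Rightarrow> real" where
  "eigvec s = (if s = 1 then t else 1)"

text \<open>Doob transform of the transfer matrix: conjugation by the Perron eigenvector and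
  division by the eigenvalue. The two eigenvalue equations are exactly the statement that its rows
  sum to 1.\<close>

definition kern :: "real \<Rightarrow> real \<Rightarrow> real" where
  "kern s b = exp (J * s * b + h * b) * eigvec b / (lam * eigvec s)"

text \<open>A root has no bond to a parent, so only the field and the eigenvector entry remain,
  normalised. This is the free left end of a chain.\<close>

definition start :: "real \<Rightarrow> real" where
  "start b = exp (h * b) * eigvec b / (exp h * t + exp (- h))"

lemma eigvec_pos: "eigvec s > 0"
  using t_pos by (simp add: eigvec_def)

lemma kern_pos: "kern s b > 0"
  using eigvec_pos lam_pos by (simp add: kern_def)

lemma start_pos: "start b > 0"
  using eigvec_pos t_pos by (simp add: start_def add_pos_pos)

lemma kern_sum: "s \<in> {-1, 1} \<Longrightarrow> kern s 1 + kern s (-1) = 1"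
  using t_pos lam_pos eigen_plus eigen_minus
  by (auto simp: kern_def eigvec_def simp flip: add_divide_distrib)

lemma start_sum: "start 1 + start (-1) = 1"
proof -
  have "exp h * t + exp (- h) > 0"
    using t_pos by (simp add: add_pos_pos)
  then show ?thesis
    by (simp add: start_def eigvec_def flip: add_divide_distrib)
qed

lemma kern_le_1: "s \<in> {-1, 1} \<Longrightarrow> kern s b \<le> 1" if "b \<in> {-1, 1}"
  using kern_sum[of s] kern_pos[of s 1] kern_pos[of s "-1"] that by auto

lemma start_le_1: "b \<in> {-1, 1} \<Longrightarrow> start b \<le> 1"
  using start_sum start_pos[of 1] start_pos[of "-1"] by auto

text \<open>The modulus of the second eigenvalue of the stochastic matrix \<open>kern\<close>; it is
  below 1 because all four entries are positive.\<close>

definition contraction :: real where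
  "contraction = \<bar>kern 1 1 - kern (-1) 1\<bar>"

lemma contraction: "0 \<le> contraction" "contraction < 1"
  using kern_pos[of 1 1] kern_pos[of 1 "-1"] kern_pos[of "-1" 1] kern_pos[of "-1" "-1"]
    kern_sum[of 1] kern_sum[of "-1"]
  by (auto simp: contraction_def)

text \<open>The two rows differ by a multiple of (1, -1), so the difference of the averages sees
  only x - y.\<close>

lemma kern_avg_diff:
  "\<bar>(kern 1 1 * x + kern 1 (-1) * y) - (kern (-1) 1 * x + kern (-1) (-1) * y)\<bar> = contraction * \<bar>x - y\<bar>"
proof -
  have k: "kern 1 (-1) = 1 - kern 1 1" "kern (-1) (-1) = 1 - kern (-1) 1"
    using kern_sum[of 1] kern_sum[of "-1"] by auto
  have "(kern 1 1 * x + kern 1 (-1) * y) - (kern (-1) 1 * x + kern (-1) (-1) * y) =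
      (kern 1 1 - kern (-1) 1) * (x - y)"
    unfolding k by (simp add: algebra_simps)
  then show ?thesis
    by (simp add: contraction_def abs_mult)
qed

lemma kern_avg_bounds:
  assumes "s \<in> {-1, 1}" "lo \<le> x" "x \<le> hi" "lo \<le> y" "y \<le> hi"
  shows "lo \<le> kern s 1 * x + kern s (-1) * y" "kern s 1 * x + kern s (-1) * y \<le> hi"
proof -
  have k: "kern s (-1) = 1 - kern s 1" "0 \<le> kern s 1" "kern s 1 \<le> 1"
    using kern_sum[of s] kern_pos[of s 1] kern_pos[of s "-1"] assms by auto
  show "lo \<le> kern s 1 * x + kern s (-1) * y" "kern s 1 * x + kern s (-1) * y \<le> hi"
    using convex_bound_le[of x hi y "kern s 1" "1 - kern s 1"]
      convex_bound_le[of "-x" "-lo" "-y" "kern s 1" "1 - kern s 1"] assms k by auto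
qed

definition spin :: "bool \<Rightarrow> real" where
  "spin b = (if b then 1 else -1)"

text \<open>The two components of the noise at a site are its spin given parent spin \<open>1\<close> and \<open>-1\<close>.
  Roots answer to a virtual parent spin, so their two components agree.\<close>

definition answer :: "bool \<times> bool \<Rightarrow> real \<Rightarrow> real" where
  "answer w s = spin (if s = 1 then fst w else snd w)"

definition root_noise :: "(bool \<times> bool) pmf" where
  "root_noise = map_pmf (\<lambda>b. (b, b)) (bernoulli_pmf (start 1))"

text \<open>Both answers are drawn before the parent spin is known, so the dependence between sites
  sits entirely in how the noise is read.\<close>

definition child_noise :: "(bool \<times> bool) pmf" where
  "child_noise = pair_pmf (bernoulli_pmf (kern 1 1)) (bernoulli_pmf (kern (-1) 1))"

lemma measure_bernoulli_spin:
  assumes "0 \<le> q" "q \<le> 1" "b \<in> {-1, 1}"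
  shows "measure (measure_pmf (bernoulli_pmf q)) {x. spin x = b} = (if b = 1 then q else 1 - q)"
proof -
  have "{x. spin x = b} = {b = 1}"
    using assms by (auto simp: spin_def)
  then show ?thesis
    using assms by (auto simp: measure_pmf_single)
qed

lemma measure_root_noise:
  assumes "b \<in> {-1, 1}"
  shows "measure (measure_pmf root_noise) {w. answer w s = b} = start b"
proof -
  have "measure (measure_pmf root_noise) {w. answer w s = b} =
      measure (measure_pmf (bernoulli_pmf (start 1))) {x. spin x = b}"
    by (simp add: root_noise_def answer_def vimage_def)
  also have "\<dots> = start b"
    using start_le_1[of 1] start_pos[of 1] start_sum assms
    by (subst measure_bernoulli_spin) auto
  finally show ?thesis .
qed

lemma map_answer_child_noise:
  "s \<in> {-1, 1} \<Longrightarrow> map_pmf (\<lambda>w. if s = 1 then fst w else snd w) child_noise = bernoulli_pmf (kern s 1)"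
  by (auto simp: child_noise_def map_fst_pair_pmf map_snd_pair_pmf)

lemma measure_child_noise:
  assumes "s \<in> {-1, 1}" "b \<in> {-1, 1}"
  shows "measure (measure_pmf child_noise) {w. answer w s = b} = kern s b"
proof -
  have "measure (measure_pmf child_noise) {w. answer w s = b} =
      measure (measure_pmf (map_pmf (\<lambda>w. if s = 1 then fst w else snd w) child_noise)) {x. spin x = b}"
    by (simp add: answer_def vimage_def)
  also have "\<dots> = kern s b"
    using kern_le_1[of 1 s] kern_pos[of s 1] kern_sum[of s] assms
    unfolding map_answer_child_noise[OF assms(1)]
    by (subst measure_bernoulli_spin) auto
  finally show ?thesis .
qed

end


text \<open>The graph joins each \<open>i \<ge> a\<close> to \<open>c i\<close>, a disjoint union of half-lines. The Ising chain is
  \<open>a = 0, c = Suc\<close>; the multiplicative model is \<open>a = 1, c = (\<lambda>i. 2 * i)\<close>. The volume of size \<open>n\<close> is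
  \<open>{a..<n}\<close>, and \<open>bd n\<close> below collects its sites whose child lies outside.\<close>

locale spin_forest = ising_kernel +
  fixes a :: nat and c :: "nat \<Rightarrow> nat"
  assumes c_gt: "a \<le> i \<Longrightarrow> i < c i" and c_inj: "inj_on c {a..}"
begin

definition parent :: "nat \<Rightarrow> nat" where
  "parent j = inv_into {a..} c j"

definition nonroot :: "nat \<Rightarrow> bool" where
  "nonroot j \<longleftrightarrow> j \<in> c ` {a..}"

lemma nonroot_c: "a \<le> i \<Longrightarrow> nonroot (c i)"
  by (simp add: nonroot_def)

lemma parent_c: "a \<le> i \<Longrightarrow> parent (c i) = i"
  using c_inj by (simp add: parent_def)

lemma nonrootE:
  assumes "nonroot j"
  obtains i where "a \<le> i" "j = c i" "parent j = i" "i < j"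
  using assms parent_c c_gt by (auto simp: nonroot_def)

text \<open>The conditional probability of the spin at \<open>j\<close> given the spins at smaller
  sites. \<open>parent\<close> is an inverse image and meaningful only at nonroots, hence the
  guard.\<close>

definition site :: "(nat \<Rightarrow> real) \<Rightarrow> nat \<Rightarrow> real" where
  "site \<sigma> j = (if nonroot j then kern (\<sigma> (parent j)) (\<sigma> j) else start (\<sigma> j))"

definition cyl_prob :: "nat \<Rightarrow> (nat \<Rightarrow> real) \<Rightarrow> real" where
  "cyl_prob n \<sigma> = (\<Prod>j\<in>{a..<n}. site \<sigma> j)"

lemma cyl_prob_pos: "cyl_prob n \<sigma> > 0"
  by (auto simp: cyl_prob_def site_def kern_pos start_pos intro!: prod_pos)

section \<open>Spins as functions of independent noise\<close>

function config :: "(nat \<Rightarrow> bool \<times> bool) \<Rightarrow> nat \<Rightarrow> real" where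
  "config W j = answer (W j) (if nonroot j then config W (parent j) else 1)"
  by auto
termination
  by (relation "Wellfounded.measure snd") (auto elim: nonrootE)

declare config.simps[simp del]

lemma config_c: "a \<le> i \<Longrightarrow> config W (c i) = answer (W (c i)) (config W i)"
  by (subst config.simps) (simp add: nonroot_c parent_c)

lemma config_root: "\<not> nonroot j \<Longrightarrow> config W j = answer (W j) 1"
  by (subst config.simps) simp

definition noise_law :: "nat \<Rightarrow> (bool \<times> bool) pmf" where
  "noise_law j = (if nonroot j then child_noise else root_noise)"

definition noise :: "(nat \<Rightarrow> bool \<times> bool) measure" where
  "noise = (\<Pi>\<^sub>M j\<in>{a..}. measure_pmf (noise_law j))"

definition config_on :: "(nat \<Rightarrow> bool \<times> bool) \<Rightarrow> nat \<Rightarrow> real" where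
  "config_on W = (\<lambda>j\<in>{a..}. config W j)"

definition gibbs :: "(nat \<Rightarrow> real) measure" where
  "gibbs = distr noise (spin_algebra {a..}) config_on"

sublocale noise: product_prob_space "\<lambda>j. measure_pmf (noise_law j)" "{a..}"
  by unfold_locales

lemma prob_space_noise: "prob_space noise"
  unfolding noise_def by (rule noise.P.prob_space_axioms)

lemma measurable_config: "a \<le> j \<Longrightarrow> (\<lambda>W. config W j) \<in> measurable noise (count_space {-1, 1})"
proof (induction j rule: less_induct)
  case (less j)
  have coord: "(\<lambda>W. W j) \<in> measurable noise (count_space UNIV)"
    using less.prems measurable_component_singleton[of j "{a..}" "\<lambda>j. measure_pmf (noise_law j)"]
    by (subst measurable_cong_sets[OF refl, of _ "measure_pmf (noise_law j)"]) (simp_all add: noise_def)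
  have A: "(\<lambda>w. answer w s) \<in> measurable (count_space UNIV) (count_space {-1, 1})" for s
    by (simp add: answer_def spin_def)
  have B: "(\<lambda>W. answer (W j) s) \<in> measurable noise (count_space {-1, 1})" for s
    by (rule measurable_compose[OF coord A])
  show ?case
  proof (cases "nonroot j")
    case True
    then obtain i where i: "a \<le> i" "j = c i" "parent j = i" "i < j"
      by (rule nonrootE)
    have IH: "(\<lambda>W. config W i) \<in> measurable noise (count_space {-1, 1})"
      using less.IH i by simp
    have "(\<lambda>W. answer (W j) (config W i)) \<in> measurable noise (count_space {-1, 1})"
      \<comment> \<open>The parent spin selects which answer is read; it takes two values, and for
        each fixed value the answer is measurable.\<close>
      by (rule measurable_compose_countable'[OF B IH]) simp
    then show ?thesis
      using True i by (simp add: config_c)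
  next
    case False
    then show ?thesis
      using B[of 1] by (simp add: config_root)
  qed
qed

lemma measurable_config_on: "config_on \<in> measurable noise (spin_algebra {a..})"
  unfolding config_on_def spin_algebra_def
  by (intro measurable_restrict) (simp add: measurable_config)

lemma prob_space_gibbs: "prob_space gibbs"
  unfolding gibbs_def by (rule prob_space.prob_space_distr[OF prob_space_noise measurable_config_on])

lemma sets_gibbs: "sets gibbs = sets (spin_algebra {a..})"
  by (simp add: gibbs_def)

lemma space_gibbs: "space gibbs = spin_configs {a..}"
  by (simp add: gibbs_def space_spin_algebra)

text \<open>On the event that all spins in the window agree with \<zeta>, each site answers to the
  prescribed parent spin instead of a random one. The event therefore becomes a rectangle in the
  noise, and its probability a product of one-site probabilities.\<close>

lemma measure_gibbs_cylinder:
  assumes \<zeta>: "\<zeta> \<in> spin_configs {a..<n}"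
  shows "measure gibbs {\<sigma> \<in> space gibbs. restrict \<sigma> {a..<n} = \<zeta>} = cyl_prob n \<zeta>"
proof -
  have ivl: "{a..<n} \<subseteq> {a..}"
    by auto
  define R where "R j = {w. answer w (if nonroot j then \<zeta> (parent j) else 1) = \<zeta> j}" for j
  have iff: "restrict (config_on W) {a..<n} = \<zeta> \<longleftrightarrow> (\<forall>j\<in>{a..<n}. W j \<in> R j)" for W
  proof
    assume eq: "restrict (config_on W) {a..<n} = \<zeta>"
    have val: "\<zeta> j = config W j" if "a \<le> j" "j < n" for j
      using fun_cong[OF eq, of j] that by (simp add: config_on_def)
    show "\<forall>j\<in>{a..<n}. W j \<in> R j"
    proof
      fix j assume j: "j \<in> {a..<n}"
      show "W j \<in> R j"
      proof (cases "nonroot j")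
        case True
        then obtain i where i: "a \<le> i" "j = c i" "parent j = i" "i < j"
          by (rule nonrootE)
        then show ?thesis
          using True j val[of i] val[of j] by (simp add: R_def config_c)
      next
        case False
        then show ?thesis
          using j val[of j] by (simp add: R_def config_root)
      qed
    qed
  next
    assume R: "\<forall>j\<in>{a..<n}. W j \<in> R j"
    have "config W j = \<zeta> j" if "a \<le> j" "j < n" for j
      using that
    proof (induction j rule: less_induct)
      case (less j)
      have Rj: "W j \<in> R j"
        using R less.prems by simp
      show ?case
      proof (cases "nonroot j")
        case True
        then obtain i where i: "a \<le> i" "j = c i" "parent j = i" "i < j"
          by (rule nonrootE)
        then show ?thesis
          using True Rj less by (simp add: R_def config_c)
      next
        case False
        then show ?thesis
          using Rj by (simp add: R_def config_root)
      qed
    qed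
    then show "restrict (config_on W) {a..<n} = \<zeta>"
      using \<zeta> by (auto simp: config_on_def fun_eq_iff spin_configs_def PiE_iff extensional_def)
  qed
  have "measure gibbs {\<sigma> \<in> space gibbs. restrict \<sigma> {a..<n} = \<zeta>} =
      measure noise {W \<in> space noise. \<forall>j\<in>{a..<n}. W j \<in> R j}"
    unfolding gibbs_def
    using measurable_config_on
      cylinder_measurable_singleton[of "spin_algebra {a..}", OF refl finite_atLeastLessThan ivl \<zeta>]
    by (subst measure_distr) (auto simp: iff space_spin_algebra dest: measurable_space intro!: arg_cong[where f = "measure noise"])
  also have "\<dots> = (\<Prod>j\<in>{a..<n}. measure (measure_pmf (noise_law j)) (R j))"
    unfolding noise_def
    by (rule measure_eq_emeasure_eq_ennreal)
      (auto simp: noise.emeasure_PiM_Collect[OF ivl] measure_pmf.emeasure_eq_measure prod_ennreal intro: prod_nonneg)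
  also have "\<dots> = cyl_prob n \<zeta>"
    unfolding cyl_prob_def
  proof (rule prod.cong)
    fix j assume j: "j \<in> {a..<n}"
    show "measure (measure_pmf (noise_law j)) (R j) = site \<zeta> j"
      using j spin_configsD[OF \<zeta>, of j] spin_configsD[OF \<zeta>, of "parent j"]
      by (auto simp: R_def site_def noise_law_def measure_root_noise measure_child_noise elim!: nonrootE)
  qed simp
  finally show ?thesis .
qed

end

subsection \<open>Effective boundary fields\<close>

context spin_forest
begin

definition bd :: "nat \<Rightarrow> nat set" where
  "bd n = {i \<in> {a..<n}. n \<le> c i}"

lemma finite_bd: "finite (bd n)"
  by (simp add: bd_def)

text \<open>A new child \<open>m\<close> takes the place of its parent in the boundary: the parent's
  only child is now inside, while \<open>m\<close> has its own child beyond.\<close>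

lemma bd_Suc_child:
  assumes "a \<le> i" "c i = m"
  shows "bd (Suc m) = insert m (bd m - {i})" "i \<in> bd m" "m \<notin> bd m"
  using assms c_gt[of i] c_gt[of m] inj_onD[OF c_inj, of i]
  by (force simp: bd_def Suc_le_eq le_less)+

lemma bd_Suc_root:
  assumes "a \<le> m" "\<not> nonroot m"
  shows "bd (Suc m) = insert m (bd m)" "m \<notin> bd m"
  using assms c_gt[of m] by (auto simp: bd_def nonroot_def Suc_le_eq le_less)

lemma ivl_Suc: "a \<le> m \<Longrightarrow> {a..<Suc m} = insert m {a..<m}"
  by auto

lemma site_cong: "a \<le> j \<Longrightarrow> (\<And>i. i \<in> {a..j} \<Longrightarrow> \<sigma> i = \<sigma>' i) \<Longrightarrow> site \<sigma> j = site \<sigma>' j"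
  by (auto simp: site_def elim!: nonrootE)

lemma cyl_prob_cong: "(\<And>i. i \<in> {a..<n} \<Longrightarrow> \<sigma> i = \<sigma>' i) \<Longrightarrow> cyl_prob n \<sigma> = cyl_prob n \<sigma>'"
  unfolding cyl_prob_def by (intro prod.cong refl site_cong) auto

lemma cyl_prob_Suc: "a \<le> m \<Longrightarrow> cyl_prob (Suc m) \<sigma> = cyl_prob m \<sigma> * site \<sigma> m"
  by (simp add: cyl_prob_def)

text \<open>The field that the sites beyond the volume, integrated out against weights \<open>f\<close> on the
  boundary, exert on site \<open>i\<close>.\<close>

function field :: "(nat \<Rightarrow> real \<Rightarrow> real) \<Rightarrow> nat \<Rightarrow> nat \<Rightarrow> real \<Rightarrow> real" where
  "field f n i s =
    (if i < c i \<and> c i < n then kern s 1 * field f n (c i) 1 + kern s (-1) * field f n (c i) (-1)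
     else f i s)"
  by auto
text \<open>The guard \<open>i < c i\<close> makes \<open>n - i\<close> decrease also below
  \<open>a\<close>, where \<open>c\<close> is unconstrained.\<close>

termination
  by (relation "Wellfounded.measure (\<lambda>(f, n, i, s). n - i)") auto

declare field.simps[simp del]

lemma field_boundary: "n \<le> c i \<Longrightarrow> field f n i s = f i s"
  by (subst field.simps) simp

lemma field_interior: "a \<le> i \<Longrightarrow> c i < n \<Longrightarrow>
    field f n i s = kern s 1 * field f n (c i) 1 + kern s (-1) * field f n (c i) (-1)"
  using c_gt by (subst field.simps) simp

lemma field_bounds:
  assumes f: "\<And>i s. a \<le> i \<Longrightarrow> s \<in> {-1, 1} \<Longrightarrow> f i s \<in> {lo..hi}"
    and "a \<le> i" "s \<in> {-1, 1}"
  shows "field f n i s \<in> {lo..hi}"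
  using assms(2,3)
proof (induction "n - i" arbitrary: i s rule: less_induct)
  case less
  show ?case
  proof (cases "c i < n")
    case True
    have *: "field f n (c i) b \<in> {lo..hi}" if "b \<in> {-1, 1}" for b
      using less True c_gt[of i] that by (intro less.hyps) auto
    show ?thesis
      using kern_avg_bounds[of s lo "field f n (c i) 1" hi "field f n (c i) (-1)"]
        *[of 1] *[of "-1"] less.prems True by (simp add: field_interior)
  next
    case False
    then show ?thesis
      using f less.prems by (simp add: field_boundary)
  qed
qed

lemma c_funpow_ge: "a \<le> i \<Longrightarrow> i \<le> (c ^^ l) i"
proof (induction l)
  case (Suc l)
  then show ?case
    using c_gt[of "(c ^^ l) i"] by simp
qed simp

text \<open>Each generation between \<open>i\<close> and the boundary contributes one factor of
  \<open>contraction\<close>. If the l-th descendant is still inside, the recursion can be unfolded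
  l times before the crude bound \<open>hi - lo\<close> is used.\<close>

lemma field_diff_bound:
  assumes f: "\<And>i s. a \<le> i \<Longrightarrow> s \<in> {-1, 1} \<Longrightarrow> f i s \<in> {lo..hi}"
    and "a \<le> i" "(c ^^ l) i < n"
  shows "\<bar>field f n i 1 - field f n i (-1)\<bar> \<le> contraction ^ l * (hi - lo)"
  using assms(2,3)
proof (induction l arbitrary: i)
  case 0
  then show ?case
    using field_bounds[where f = f, OF f, of i 1 n] field_bounds[where f = f, OF f, of i "-1" n] by auto
next
  case (Suc l)
  have ci: "a \<le> c i" "c i < n"
    using Suc.prems c_gt[of i] c_funpow_ge[of "c i" l] by (auto simp: funpow_swap1)
  have "\<bar>field f n i 1 - field f n i (-1)\<bar> =
      contraction * \<bar>field f n (c i) 1 - field f n (c i) (-1)\<bar>"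
    using Suc.prems ci by (simp only: field_interior kern_avg_diff)
  also have "\<dots> \<le> contraction * (contraction ^ l * (hi - lo))"
    using Suc.prems ci contraction by (intro mult_left_mono Suc.IH) (auto simp: funpow_swap1)
  finally show ?case by simp
qed

text \<open>The oscillation vanishes while the field stays above \<open>lo\<close>. The ratio is the
  right quantity because a common factor cancels in normalised probabilities.\<close>

lemma field_ratio_tendsto_1:
  assumes f: "\<And>i s. a \<le> i \<Longrightarrow> s \<in> {-1, 1} \<Longrightarrow> f i s \<in> {lo..hi}" and lo: "lo > 0"
    and i: "a \<le> i" and s: "s \<in> {-1, 1}"
  shows "(\<lambda>n. field f n i s / field f n i 1) \<longlonglongrightarrow> 1"
proof -
  have "(\<lambda>n. field f n i 1 - field f n i (-1)) \<longlonglongrightarrow> 0"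
  proof (rule LIMSEQ_I)
    fix r :: real assume r: "r > 0"
    have "(\<lambda>l. contraction ^ l * (hi - lo)) \<longlonglongrightarrow> 0"
      using contraction by (intro tendsto_mult_left_zero LIMSEQ_power_zero) simp
    then have "eventually (\<lambda>l. contraction ^ l * (hi - lo) < r) sequentially"
      using r by (rule order_tendstoD)
    then obtain l where l: "contraction ^ l * (hi - lo) < r"
      by (auto simp: eventually_sequentially)
    show "\<exists>no. \<forall>n\<ge>no. norm (field f n i 1 - field f n i (-1) - 0) < r"
      using field_diff_bound[where f = f, OF f i, of l] l
      \<comment> \<open>The depth l is fixed by the required precision; the volume only has to
        contain the l-th descendant.\<close>
      by (intro exI[of _ "Suc ((c ^^ l) i)"]) (force simp: Suc_le_eq)
  qed
  then have lim: "(\<lambda>n. field f n i s - field f n i 1) \<longlonglongrightarrow> 0"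
    using s tendsto_minus[of "\<lambda>n. field f n i 1 - field f n i (-1)" 0 sequentially] by auto
  have ge: "lo \<le> field f n i 1" for n
    using field_bounds[where f = f, OF f i, of 1 n] by simp
  have "(\<lambda>n. (field f n i s - field f n i 1) / field f n i 1) \<longlonglongrightarrow> 0"
  proof (rule Lim_null_comparison)
    show "(\<lambda>n. \<bar>field f n i s - field f n i 1\<bar> / lo) \<longlonglongrightarrow> 0"
      using tendsto_divide[OF tendsto_rabs[OF lim] tendsto_const, of lo] lo by simp
    show "eventually (\<lambda>n. norm ((field f n i s - field f n i 1) / field f n i 1)
        \<le> \<bar>field f n i s - field f n i 1\<bar> / lo) sequentially"
    proof (rule always_eventually, rule allI)
      fix n
      show "norm ((field f n i s - field f n i 1) / field f n i 1) \<le> \<bar>field f n i s - field f n i 1\<bar> / lo"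
        using lo ge[of n] by (auto simp: abs_divide intro!: divide_left_mono mult_pos_pos)
    qed
  qed
  then have "(\<lambda>n. 1 + (field f n i s - field f n i 1) / field f n i 1) \<longlonglongrightarrow> 1 + 0"
    by (intro tendsto_intros)
  moreover have "1 + (field f n i s - field f n i 1) / field f n i 1 = field f n i s / field f n i 1" for n
    using lo ge[of n] by (simp add: field_simps)
  ultimately show ?thesis by simp
qed

text \<open>The last site of the volume is summed out repeatedly. Since \<open>C\<close> does not
  depend on the test function \<phi>, it cancels between a cylinder weight and the partition
  function; arbitrary \<phi> also lets the induction hypothesis be used for functions of a smaller
  window.\<close>

lemma marginal_sum:
  assumes f: "\<And>i s. a \<le> i \<Longrightarrow> s \<in> {-1, 1} \<Longrightarrow> 0 < f i s" and m: "a \<le> m" "m \<le> n"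
  shows "\<exists>C>0. \<forall>\<phi>. (\<Sum>\<omega>\<in>spin_configs {a..<n}.
        \<phi> (restrict \<omega> {a..<m}) * (cyl_prob n \<omega> * (\<Prod>i\<in>bd n. f i (\<omega> i)))) =
      C * (\<Sum>\<zeta>\<in>spin_configs {a..<m}. \<phi> \<zeta> * (cyl_prob m \<zeta> * (\<Prod>i\<in>bd m. field f n i (\<zeta> i))))"
  using m(2,1)
proof (induction rule: inc_induct)
  case base
  show ?case
    by (intro exI[of _ 1]) (auto simp: bd_def field_boundary restrict_spin_configs_eq intro!: sum.cong)
next
  case (step m)
  obtain C where C: "C > 0" and IH: "\<And>\<phi>. (\<Sum>\<omega>\<in>spin_configs {a..<n}.
        \<phi> (restrict \<omega> {a..<Suc m}) * (cyl_prob n \<omega> * (\<Prod>i\<in>bd n. f i (\<omega> i)))) =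
      C * (\<Sum>\<zeta>\<in>spin_configs {a..<Suc m}. \<phi> \<zeta> *
        (cyl_prob (Suc m) \<zeta> * (\<Prod>i\<in>bd (Suc m). field f n i (\<zeta> i))))"
    using step.IH[OF le_SucI[OF step.prems]] by blast
  have fpos: "field f n i s > 0" if "a \<le> i" "s \<in> {-1, 1}" for i s
    using that
  proof (induction "n - i" arbitrary: i s rule: less_induct)
    case less
    show ?case
    proof (cases "c i < n")
      case True
      have "field f n (c i) b > 0" if "b \<in> {-1, 1}" for b
        using less True c_gt[of i] that by (intro less.hyps) auto
      then show ?thesis
        using less.prems True by (simp add: field_interior kern_pos add_pos_pos)
    next
      case False
      then show ?thesis
        using f less.prems by (simp add: field_boundary)
    qed
  qed
  \<comment> \<open>A child is absorbed into the field of its parent at no cost; a root is tied to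
    no smaller site and leaves its averaged field as a constant.\<close>
  define D where "D = (if nonroot m then 1 else start 1 * field f n m 1 + start (-1) * field f n m (-1))"
  have D: "D > 0"
    using fpos[of m] step.prems by (auto simp: D_def start_pos add_pos_pos)
  let ?w = "\<lambda>k \<zeta>. cyl_prob k \<zeta> * (\<Prod>i\<in>bd k. field f n i (\<zeta> i))"
  have one_site: "?w (Suc m) (\<zeta>(m := 1)) + ?w (Suc m) (\<zeta>(m := -1)) = D * ?w m \<zeta>" for \<zeta>
  proof -
    have cp: "cyl_prob (Suc m) (\<zeta>(m := b)) = cyl_prob m \<zeta> * site (\<zeta>(m := b)) m" for b
      using step.prems cyl_prob_cong[of m "\<zeta>(m := b)" \<zeta>] by (simp add: cyl_prob_Suc)
    show ?thesis
    proof (cases "nonroot m")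
      case True
      then obtain i where i: "a \<le> i" "m = c i" "parent m = i" "i < m"
        by (rule nonrootE)
      note bd = bd_Suc_child[OF i(1) i(2)[symmetric]]
      have pr: "(\<Prod>j\<in>bd (Suc m). field f n j ((\<zeta>(m := b)) j)) =
          field f n m b * (\<Prod>j\<in>bd m - {i}. field f n j (\<zeta> j))" for b
      proof -
        have "(\<Prod>j\<in>bd m - {i}. field f n j ((\<zeta>(m := b)) j)) = (\<Prod>j\<in>bd m - {i}. field f n j (\<zeta> j))"
          using bd(3) by (intro prod.cong) auto
        then show ?thesis
          using bd finite_bd[of m] by simp
      qed
      have "?w (Suc m) (\<zeta>(m := 1)) + ?w (Suc m) (\<zeta>(m := -1)) =
          cyl_prob m \<zeta> * (field f n i (\<zeta> i) * (\<Prod>j\<in>bd m - {i}. field f n j (\<zeta> j)))"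
        unfolding cp pr using True i step.hyps
        by (simp add: site_def field_interior algebra_simps)
      also have "\<dots> = D * ?w m \<zeta>"
        using prod.remove[OF finite_bd bd(2), of "\<lambda>j. field f n j (\<zeta> j)"] True by (simp add: D_def)
      finally show ?thesis .
    next
      case False
      note bd = bd_Suc_root[OF step.prems False]
      have pr: "(\<Prod>j\<in>bd (Suc m). field f n j ((\<zeta>(m := b)) j)) =
          field f n m b * (\<Prod>j\<in>bd m. field f n j (\<zeta> j))" for b
      proof -
        have "(\<Prod>j\<in>bd m. field f n j ((\<zeta>(m := b)) j)) = (\<Prod>j\<in>bd m. field f n j (\<zeta> j))"
          using bd(2) by (intro prod.cong) auto
        then show ?thesis
          using bd finite_bd[of m] by simp
      qed
      show ?thesis
        unfolding cp pr using False by (simp add: site_def D_def algebra_simps)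
    qed
  qed
  have "(\<Sum>\<omega>\<in>spin_configs {a..<n}.
        \<phi> (restrict \<omega> {a..<m}) * (cyl_prob n \<omega> * (\<Prod>i\<in>bd n. f i (\<omega> i)))) =
      (C * D) * (\<Sum>\<zeta>\<in>spin_configs {a..<m}. \<phi> \<zeta> * ?w m \<zeta>)" for \<phi>
  proof -
    have r: "restrict (restrict \<omega> {a..<Suc m}) {a..<m} = restrict \<omega> {a..<m}" for \<omega> :: "nat \<Rightarrow> real"
      by (auto simp: Int_absorb1)
    have r': "restrict (\<zeta>(m := b)) {a..<m} = \<zeta>" if "\<zeta> \<in> spin_configs {a..<m}" for \<zeta> b
      using that restrict_spin_configs_eq[OF that]
      by (auto simp: spin_configs_def PiE_iff extensional_def fun_eq_iff)
    have "(\<Sum>\<omega>\<in>spin_configs {a..<n}.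
        \<phi> (restrict \<omega> {a..<m}) * (cyl_prob n \<omega> * (\<Prod>i\<in>bd n. f i (\<omega> i)))) =
      C * (\<Sum>\<zeta>\<in>spin_configs (insert m {a..<m}). \<phi> (restrict \<zeta> {a..<m}) * ?w (Suc m) \<zeta>)"
      using IH[of "\<lambda>\<omega>. \<phi> (restrict \<omega> {a..<m})"] step.prems by (simp add: r ivl_Suc)
    also have "\<dots> = C * (\<Sum>\<zeta>\<in>spin_configs {a..<m}.
        \<phi> \<zeta> * (?w (Suc m) (\<zeta>(m := 1)) + ?w (Suc m) (\<zeta>(m := -1))))"
      by (subst sum_spin_configs_insert) (auto simp only: r' distrib_left atLeastLessThan_iff intro!: arg_cong[where f = "(*) C"] sum.cong)
    also have "\<dots> = (C * D) * (\<Sum>\<zeta>\<in>spin_configs {a..<m}. \<phi> \<zeta> * ?w m \<zeta>)"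
      by (simp only: one_site sum_distrib_left mult.left_commute mult.assoc)
    finally show ?thesis .
  qed
  then show ?case
    using mult_pos_pos[OF C D] by blast
qed

end

subsection \<open>Finite-volume limits\<close>

context spin_forest
begin

text \<open>The sign is that of the Boltzmann exponent: minus the Hamiltonian of the volume with
  free boundary.\<close>

definition energy :: "nat \<Rightarrow> (nat \<Rightarrow> real) \<Rightarrow> real" where
  "energy n \<sigma> = (\<Sum>i\<in>{a..<n}. h * \<sigma> i) + (\<Sum>i\<in>{i\<in>{a..<n}. c i < n}. J * \<sigma> i * \<sigma> (c i))"

text \<open>The eigenvector entries telescope along each branch and survive only at the boundary.\<close>

lemma cyl_prob_eq_energy:
  assumes "a \<le> n"
  shows "\<exists>C>0. \<forall>\<sigma>. cyl_prob n \<sigma> = C * (exp (energy n \<sigma>) * (\<Prod>i\<in>bd n. eigvec (\<sigma> i)))"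
  using assms
proof (induction rule: dec_induct)
  case base
  show ?case
    by (intro exI[of _ 1]) (simp add: cyl_prob_def energy_def bd_def)
next
  case (step m)
  then obtain C where C: "C > 0"
    and IH: "\<And>\<sigma>. cyl_prob m \<sigma> = C * (exp (energy m \<sigma>) * (\<Prod>i\<in>bd m. eigvec (\<sigma> i)))"
    by auto
  have am: "a \<le> m" using step by simp
  show ?case
  proof (cases "nonroot m")
    case True
    then obtain i where i: "a \<le> i" "m = c i" "parent m = i" "i < m"
      by (rule nonrootE)
    note bd = bd_Suc_child[OF i(1) i(2)[symmetric]]
    \<comment> \<open>By injectivity of \<open>c\<close> the only bond gained is the one from
      \<open>i\<close> to \<open>m\<close>; the child of \<open>m\<close> is still outside.\<close>
    have set: "{j\<in>{a..<Suc m}. c j < Suc m} = insert i {j\<in>{a..<m}. c j < m}"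
    proof (intro set_eqI iffI)
      fix j assume j: "j \<in> {j\<in>{a..<Suc m}. c j < Suc m}"
      then have aj: "a \<le> j" and "c j = m \<or> c j < m"
        by auto
      then show "j \<in> insert i {j\<in>{a..<m}. c j < m}"
        using i c_gt[OF aj] parent_c[OF aj] by auto
    qed (use i in auto)
    have en: "energy (Suc m) \<sigma> = energy m \<sigma> + h * \<sigma> m + J * \<sigma> i * \<sigma> m" for \<sigma>
      unfolding energy_def set using am i by (subst sum.insert) auto
    \<comment> \<open>The parent leaves the boundary; its entry cancels against the denominator of
      \<open>kern\<close>.\<close>
    have pr: "(\<Prod>j\<in>bd (Suc m). eigvec (\<sigma> j)) = eigvec (\<sigma> m) * (\<Prod>j\<in>bd m. eigvec (\<sigma> j)) / eigvec (\<sigma> i)" for \<sigma>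
      using bd finite_bd[of m] prod.remove[OF finite_bd bd(2), of "\<lambda>j. eigvec (\<sigma> j)"] eigvec_pos[of "\<sigma> i"]
      by (simp add: field_simps)
    have "cyl_prob (Suc m) \<sigma> = C / lam * (exp (energy (Suc m) \<sigma>) * (\<Prod>j\<in>bd (Suc m). eigvec (\<sigma> j)))" for \<sigma>
      using True i am unfolding cyl_prob_Suc[OF am] IH en pr
      by (simp add: site_def kern_def exp_add)
    then show ?thesis
      using C lam_pos by (intro exI[of _ "C / lam"]) simp
  next
    case False
    note bd = bd_Suc_root[OF am False]
    have set: "{j\<in>{a..<Suc m}. c j < Suc m} = {j\<in>{a..<m}. c j < m}"
      using False c_gt[of m] am by (auto simp: less_Suc_eq nonroot_def)
    have en: "energy (Suc m) \<sigma> = energy m \<sigma> + h * \<sigma> m" for \<sigma>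
      unfolding energy_def set using am by simp
    have pr: "(\<Prod>j\<in>bd (Suc m). eigvec (\<sigma> j)) = eigvec (\<sigma> m) * (\<Prod>j\<in>bd m. eigvec (\<sigma> j))" for \<sigma>
      using bd finite_bd[of m] by simp
    define Z where "Z = exp h * t + exp (- h)"
    have Z: "Z > 0"
      using t_pos by (simp add: Z_def add_pos_pos)
    have "cyl_prob (Suc m) \<sigma> = C / Z * (exp (energy (Suc m) \<sigma>) * (\<Prod>j\<in>bd (Suc m). eigvec (\<sigma> j)))" for \<sigma>
      using False unfolding cyl_prob_Suc[OF am] IH en pr
      by (simp add: site_def start_def exp_add Z_def[symmetric])
    then show ?thesis
      using C Z by (intro exI[of _ "C / Z"]) simp
  qed
qed

text \<open>The total mass of the probability measure \<open>gibbs\<close>, split into the atoms of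
  the window.\<close>

lemma sum_cyl_prob: "(\<Sum>\<zeta>\<in>spin_configs {a..<m}. cyl_prob m \<zeta>) = 1"
proof -
  interpret G: prob_space gibbs by (rule prob_space_gibbs)
  have "(\<Sum>\<zeta>\<in>spin_configs {a..<m}. cyl_prob m \<zeta>) =
      (\<Sum>\<zeta>\<in>{\<zeta>\<in>spin_configs {a..<m}. restrict \<zeta> {a..<m} \<in> spin_configs {a..<m}}.
        measure gibbs {\<sigma> \<in> space gibbs. restrict \<sigma> {a..<m} = \<zeta>})"
    by (intro sum.cong) (auto simp: measure_gibbs_cylinder restrict_spin_configs_eq)
  also have "\<dots> = measure gibbs {\<sigma> \<in> space gibbs. restrict \<sigma> {a..<m} \<in> spin_configs {a..<m}}"
    by (intro measure_cylinder_eq_sum[symmetric, where I = "{a..}"]) (auto simp: sets_gibbs G.finite_measure_axioms)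
  also have "\<dots> = measure gibbs (space gibbs)"
    by (intro arg_cong[where f = "measure gibbs"])
      (auto simp: space_gibbs intro: restrict_spin_configs)
  finally show ?thesis
    by (simp add: G.prob_space)
qed

text \<open>The weight \<open>e\<close> encodes an arbitrary boundary condition. The window
  probability equals \<open>cyl_prob\<close> times a correction \<open>X\<close>, renormalised over
  the finitely many window configurations, and \<open>X\<close> is a product of field ratios over
  the fixed set \<open>bd m\<close>.\<close>

lemma boltzmann_cylinder_tendsto:
  assumes e: "0 < lo" "\<And>i s. a \<le> i \<Longrightarrow> s \<in> {-1, 1} \<Longrightarrow> e i s \<in> {lo..hi}"
    and H: "\<And>k \<omega>. \<omega> \<in> spin_configs {a..<N k} \<Longrightarrow>
      exp (- H k \<omega>) = exp (energy (N k) \<omega>) * (\<Prod>i\<in>bd (N k). e i (\<omega> i))"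
    and N: "filterlim N at_top sequentially"
    and m: "a \<le> m" and \<zeta>: "\<zeta> \<in> spin_configs {a..<m}"
  shows "(\<lambda>k. measure (boltzmann_measure {a..<N k} (H k))
      {\<omega> \<in> spin_configs {a..<N k}. restrict \<omega> {a..<m} = \<zeta>}) \<longlonglongrightarrow> cyl_prob m \<zeta>"
proof -
  \<comment> \<open>\<open>cyl_prob\<close> already carries the eigenvector on the boundary, so the
    prescribed weight enters relative to it.\<close>
  define f where "f i s = e i s / eigvec s" for i s
  define lo' where "lo' = lo / max t 1"
  define hi' where "hi' = hi / min t 1"
  have f: "f i s \<in> {lo'..hi'}" if "a \<le> i" "s \<in> {-1, 1}" for i s
  proof -
    have "lo \<le> e i s" "e i s \<le> hi" "min t 1 \<le> eigvec s" "eigvec s \<le> max t 1"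
      using e(2)[OF that] by (auto simp: eigvec_def)
    then show ?thesis
      unfolding f_def lo'_def hi'_def using e(1) t_pos eigvec_pos[of s]
      by (auto intro!: frac_le)
  qed
  have lo': "lo' > 0"
    using e(1) t_pos by (simp add: lo'_def)
  have fpos: "0 < f i s" if "a \<le> i" "s \<in> {-1, 1}" for i s
    using f[OF that] lo' by simp
  define X where "X n \<xi> = (\<Prod>i\<in>bd m. field f n i (\<xi> i) / field f n i 1)" for n \<xi>
  have X: "(\<lambda>n. X n \<xi>) \<longlonglongrightarrow> 1" if "\<xi> \<in> spin_configs {a..<m}" for \<xi>
  proof -
    have "(\<lambda>n. X n \<xi>) \<longlonglongrightarrow> (\<Prod>i\<in>bd m. 1)"
      unfolding X_def using that
      by (intro tendsto_prod field_ratio_tendsto_1[where f = f, OF f lo'])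
        (auto simp: bd_def dest: spin_configsD)
    then show ?thesis by simp
  qed
  have prob: "measure (boltzmann_measure {a..<n} G) {\<omega> \<in> spin_configs {a..<n}. restrict \<omega> {a..<m} = \<zeta>} =
      cyl_prob m \<zeta> * X n \<zeta> / (\<Sum>\<xi>\<in>spin_configs {a..<m}. cyl_prob m \<xi> * X n \<xi>)"
    if n: "m \<le> n" and G: "\<And>\<omega>. \<omega> \<in> spin_configs {a..<n} \<Longrightarrow>
      exp (- G \<omega>) = exp (energy n \<omega>) * (\<Prod>i\<in>bd n. e i (\<omega> i))" for n G
  proof -
    obtain C where C: "C > 0"
      and en: "\<And>\<sigma>. cyl_prob n \<sigma> = C * (exp (energy n \<sigma>) * (\<Prod>i\<in>bd n. eigvec (\<sigma> i)))"
      using cyl_prob_eq_energy[of n] m n by auto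
    have G': "exp (- G \<omega>) = 1 / C * (cyl_prob n \<omega> * (\<Prod>i\<in>bd n. f i (\<omega> i)))"
      if "\<omega> \<in> spin_configs {a..<n}" for \<omega>
    proof -
      have "(\<Prod>i\<in>bd n. eigvec (\<omega> i)) > 0"
        using eigvec_pos by (intro prod_pos) auto
      then show ?thesis
        using C G[OF that] en[of \<omega>] by (simp add: f_def prod_dividef)
    qed
    obtain D where D: "D > 0" and marg: "\<And>\<phi>. (\<Sum>\<omega>\<in>spin_configs {a..<n}.
        \<phi> (restrict \<omega> {a..<m}) * (cyl_prob n \<omega> * (\<Prod>i\<in>bd n. f i (\<omega> i)))) =
      D * (\<Sum>\<zeta>\<in>spin_configs {a..<m}. \<phi> \<zeta> * (cyl_prob m \<zeta> * (\<Prod>i\<in>bd m. field f n i (\<zeta> i))))"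
      using marginal_sum[where f = f, OF fpos m n] by blast
    define P where "P = (\<Prod>i\<in>bd m. field f n i 1)"
    have P: "P > 0"
      unfolding P_def
    proof (rule prod_pos)
      show "0 < field f n i 1" if "i \<in> bd m" for i
        using field_bounds[where f = f, OF f, of i 1 n] lo' that by (auto simp: bd_def)
    qed
    have PX: "(\<Prod>i\<in>bd m. field f n i (\<xi> i)) = P * X n \<xi>" for \<xi>
      using P by (simp add: X_def P_def prod_dividef)
    have weight: "(\<Sum>\<omega>\<in>spin_configs {a..<n}. \<phi> (restrict \<omega> {a..<m}) * exp (- G \<omega>)) =
        D * P / C * (\<Sum>\<zeta>\<in>spin_configs {a..<m}. \<phi> \<zeta> * (cyl_prob m \<zeta> * X n \<zeta>))" for \<phi>
    proof -
      have "(\<Sum>\<omega>\<in>spin_configs {a..<n}. \<phi> (restrict \<omega> {a..<m}) * exp (- G \<omega>)) =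
          1 / C * (\<Sum>\<omega>\<in>spin_configs {a..<n}.
            \<phi> (restrict \<omega> {a..<m}) * (cyl_prob n \<omega> * (\<Prod>i\<in>bd n. f i (\<omega> i))))"
        unfolding sum_distrib_left by (intro sum.cong refl) (simp add: G')
      also have "\<dots> = D * P / C * (\<Sum>\<zeta>\<in>spin_configs {a..<m}. \<phi> \<zeta> * (cyl_prob m \<zeta> * X n \<zeta>))"
        unfolding marg PX by (simp add: sum_distrib_left ac_simps)
      finally show ?thesis .
    qed
    have "(\<Sum>\<omega>\<in>{\<omega> \<in> spin_configs {a..<n}. restrict \<omega> {a..<m} = \<zeta>}. exp (- G \<omega>)) =
        (\<Sum>\<omega>\<in>spin_configs {a..<n}. of_bool (restrict \<omega> {a..<m} = \<zeta>) * exp (- G \<omega>))"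
      by (intro sum.mono_neutral_cong_left finite_spin_configs) auto
    also have "\<dots> = D * P / C * (\<Sum>\<xi>\<in>spin_configs {a..<m}. of_bool (\<xi> = \<zeta>) * (cyl_prob m \<xi> * X n \<xi>))"
      by (rule weight)
    also have "(\<Sum>\<xi>\<in>spin_configs {a..<m}. of_bool (\<xi> = \<zeta>) * (cyl_prob m \<xi> * X n \<xi>)) = cyl_prob m \<zeta> * X n \<zeta>"
      using \<zeta> by (subst sum.remove[OF finite_spin_configs \<zeta>]) auto
    finally have num: "(\<Sum>\<omega>\<in>{\<omega> \<in> spin_configs {a..<n}. restrict \<omega> {a..<m} = \<zeta>}. exp (- G \<omega>)) =
        D * P / C * (cyl_prob m \<zeta> * X n \<zeta>)" .
    \<comment> \<open>The partition function comes from the same identity with constant test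
      function, hence carries the same prefactor.\<close>
    have den: "(\<Sum>\<omega>\<in>spin_configs {a..<n}. exp (- G \<omega>)) =
        D * P / C * (\<Sum>\<xi>\<in>spin_configs {a..<m}. cyl_prob m \<xi> * X n \<xi>)"
      using weight[of "\<lambda>_. 1"] by simp
    show ?thesis
      using C D P by (subst measure_boltzmann_measure) (auto simp: num den)
  qed
  have "(\<lambda>n. cyl_prob m \<zeta> * X n \<zeta> / (\<Sum>\<xi>\<in>spin_configs {a..<m}. cyl_prob m \<xi> * X n \<xi>)) \<longlonglongrightarrow>
      cyl_prob m \<zeta> * 1 / (\<Sum>\<xi>\<in>spin_configs {a..<m}. cyl_prob m \<xi> * 1)"
    using X \<zeta> by (intro tendsto_intros) (auto simp: sum_cyl_prob)
  then have "(\<lambda>n. cyl_prob m \<zeta> * X n \<zeta> / (\<Sum>\<xi>\<in>spin_configs {a..<m}. cyl_prob m \<xi> * X n \<xi>)) \<longlonglongrightarrow> cyl_prob m \<zeta>"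
    by (simp add: sum_cyl_prob)
  from filterlim_compose[OF this N] show ?thesis
  proof (rule Lim_transform_eventually)
    have "eventually (\<lambda>k. m \<le> N k) sequentially"
      using N by (simp add: filterlim_at_top)
    then show "eventually (\<lambda>k. cyl_prob m \<zeta> * X (N k) \<zeta> / (\<Sum>\<xi>\<in>spin_configs {a..<m}. cyl_prob m \<xi> * X (N k) \<xi>) =
        measure (boltzmann_measure {a..<N k} (H k)) {\<omega> \<in> spin_configs {a..<N k}. restrict \<omega> {a..<m} = \<zeta>}) sequentially"
      by eventually_elim (simp add: prob H)
  qed
qed

text \<open>Every cylinder event is a finite union of atoms of an initial window, so convergence of
  atoms suffices. The decomposition in finite volume is valid once the volume contains the window,
  which is eventually the case.\<close>

lemma cylinder_limit_gibbs:
  assumes e: "0 < lo" "\<And>i s. a \<le> i \<Longrightarrow> s \<in> {-1, 1} \<Longrightarrow> e i s \<in> {lo..hi}"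
    and H: "\<And>k \<omega>. \<omega> \<in> spin_configs {a..<N k} \<Longrightarrow>
      exp (- H k \<omega>) = exp (energy (N k) \<omega>) * (\<Prod>i\<in>bd (N k). e i (\<omega> i))"
    and N: "filterlim N at_top sequentially"
  shows "cylinder_limit {a..} (\<lambda>k. boltzmann_measure {a..<N k} (H k)) gibbs"
  unfolding cylinder_limit_def
proof (intro conjI allI impI)
  interpret G: prob_space gibbs by (rule prob_space_gibbs)
  show "prob_space gibbs" "sets gibbs = sets (spin_algebra {a..})"
    by (simp_all add: prob_space_gibbs sets_gibbs)
  fix \<Lambda> :: "nat set" and A :: "(nat \<Rightarrow> real) set"
  assume "finite \<Lambda> \<and> \<Lambda> \<subseteq> {a..} \<and> A \<subseteq> spin_configs \<Lambda>"
  then have \<Lambda>: "finite \<Lambda>" "\<Lambda> \<subseteq> {a..}" and A: "A \<subseteq> spin_configs \<Lambda>"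
    by auto
  obtain m0 where m0: "\<Lambda> \<subseteq> {..<m0}"
    using \<Lambda>(1) finite_nat_bounded by blast
  define m where "m = max a m0"
  have m: "a \<le> m" "\<Lambda> \<subseteq> {a..<m}"
    using m0 \<Lambda>(2) by (auto simp: m_def subset_eq less_max_iff_disj)
  let ?B = "\<lambda>k. boltzmann_measure {a..<N k} (H k)"
  let ?S = "{\<zeta>\<in>spin_configs {a..<m}. restrict \<zeta> \<Lambda> \<in> A}"
  have "(\<lambda>k. \<Sum>\<zeta>\<in>?S. measure (?B k) {\<omega> \<in> spin_configs {a..<N k}. restrict \<omega> {a..<m} = \<zeta>})
      \<longlonglongrightarrow> (\<Sum>\<zeta>\<in>?S. cyl_prob m \<zeta>)"
    by (intro tendsto_sum boltzmann_cylinder_tendsto[where e = e, OF e H N m(1)]) auto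
  moreover have "(\<Sum>\<zeta>\<in>?S. cyl_prob m \<zeta>) = measure gibbs {\<sigma> \<in> space gibbs. restrict \<sigma> \<Lambda> \<in> A}"
    using m A by (subst measure_cylinder_eq_sum[where I = "{a..}" and V = "{a..<m}"])
      (auto simp: sets_gibbs G.finite_measure_axioms measure_gibbs_cylinder)
  moreover have "eventually (\<lambda>k. (\<Sum>\<zeta>\<in>?S. measure (?B k) {\<omega> \<in> spin_configs {a..<N k}. restrict \<omega> {a..<m} = \<zeta>}) =
      measure (?B k) {\<sigma> \<in> space (?B k). restrict \<sigma> \<Lambda> \<in> A}) sequentially"
  proof -
    have "eventually (\<lambda>k. m \<le> N k) sequentially"
      using N by (simp add: filterlim_at_top)
    then show ?thesis
    proof eventually_elim
      case (elim k)
      interpret B: prob_space "?B k"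
        by (rule prob_space_boltzmann_measure) simp
      show ?case
        using m A elim
        by (subst measure_cylinder_eq_sum[where I = "{a..<N k}" and V = "{a..<m}"])
          (auto simp: sets_boltzmann_measure sets_spin_algebra_finite space_boltzmann_measure B.finite_measure_axioms)
    qed
  qed
  ultimately show "(\<lambda>k. measure (?B k) {\<sigma> \<in> space (?B k). restrict \<sigma> \<Lambda> \<in> A})
      \<longlonglongrightarrow> measure gibbs {\<sigma> \<in> space gibbs. restrict \<sigma> \<Lambda> \<in> A}"
    by (auto intro: Lim_transform_eventually)
qed

end

subsection \<open>Independent layers\<close>

lemma ex_ising_kernel: "\<exists>t lam. ising_kernel J h t lam"
proof -
  define A B C D where "A = exp (J + h)" and "B = exp (- J - h)" and "C = exp (- J + h)" and "D = exp (J - h)"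
  have pos: "A > 0" "B > 0" "C > 0" "D > 0"
    by (simp_all add: A_def B_def C_def D_def)
  define r where "r = sqrt ((A - D)\<^sup>2 + 4 * B * C)"
  have r2: "r\<^sup>2 = (A - D)\<^sup>2 + 4 * B * C"
    using pos by (simp add: r_def)
  have "\<bar>A - D\<bar> < r"
    using pos unfolding r_def by (intro real_less_rsqrt) simp
  then have num: "A - D + r > 0" by linarith
  \<comment> \<open>Eliminating the eigenvalue leaves
    \<open>C * t * t + (D - A) * t - B = 0\<close>. As \<open>B * C > 0\<close>, the root of the
    discriminant exceeds \<bar>A - D\<bar>, so the larger solution is positive.\<close>
  define t where "t = (A - D + r) / (2 * C)"
  have t: "t > 0"
    using num pos by (simp add: t_def)
  have "(2 * C * t - (A - D))\<^sup>2 = r\<^sup>2"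
    using pos by (simp add: t_def)
  then have "C * (C * t * t + D * t) = C * (A * t + B)"
    unfolding r2 by (simp add: power2_eq_square algebra_simps)
  then have "C * t * t + D * t = A * t + B"
    using pos by simp
  then have "A * t + B = (C * t + D) * t"
    by (simp add: algebra_simps)
  then have "ising_kernel J h t (C * t + D)"
    using t pos by unfold_locales (auto simp: A_def B_def C_def D_def add_pos_pos)
  then show ?thesis by blast
qed

text \<open>Uniqueness of the odd part; it makes the half-lines through distinct odd numbers
  disjoint.\<close>

lemma odd_mult_power2_inject:
  fixes r r' :: nat
  shows "r * 2 ^ i = r' * 2 ^ k \<Longrightarrow> odd r \<Longrightarrow> odd r' \<Longrightarrow> r = r'"
proof (induction i arbitrary: k)
  case 0
  then show ?case by (cases k) auto
next
  case (Suc i)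
  then show ?case by (cases k) auto
qed

context spin_forest
begin

lemma indep_vars_noise: "prob_space.indep_vars noise (\<lambda>j. measure_pmf (noise_law j)) (\<lambda>j W. W j) {a..}"
proof -
  interpret N: prob_space noise by (rule prob_space_noise)
  have comp: "(\<lambda>W. W j) \<in> measurable noise (measure_pmf (noise_law j))" if "j \<in> {a..}" for j
    unfolding noise_def using that by (rule measurable_component_singleton)
  have "distr noise (\<Pi>\<^sub>M j\<in>{a..}. measure_pmf (noise_law j)) (\<lambda>W. \<lambda>j\<in>{a..}. W j) = noise"
  proof -
    have "distr noise (\<Pi>\<^sub>M j\<in>{a..}. measure_pmf (noise_law j)) (\<lambda>W. \<lambda>j\<in>{a..}. W j) = distr noise noise (\<lambda>W. W)"
      by (intro distr_cong) (auto simp: noise_def space_PiM PiE_restrict)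
    then show ?thesis by (simp add: distr_id2)
  qed
  moreover have "(\<Pi>\<^sub>M j\<in>{a..}. distr noise (measure_pmf (noise_law j)) (\<lambda>W. W j)) = noise"
    unfolding noise_def by (intro PiM_cong refl noise.PiM_component)
  ultimately show ?thesis
    using comp by (subst N.indep_vars_iff_distr_eq_PiM') auto
qed

end

section \<open>The Ising chain and the multiplicative model as forests over one kernel\<close>

sublocale ising_kernel \<subseteq> line: spin_forest J h t lam 0 Suc
  by unfold_locales auto

sublocale ising_kernel \<subseteq> mult: spin_forest J h t lam "Suc 0" "(*) 2"
  by unfold_locales (auto simp: inj_on_def)

context ising_kernel
begin

lemma line_nonroot: "line.nonroot j \<longleftrightarrow> j \<noteq> 0"
  using not0_implies_Suc by (auto simp: line.nonroot_def image_iff)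

lemma mult_nonroot: "Suc 0 \<le> j \<Longrightarrow> mult.nonroot j \<longleftrightarrow> even j"
  by (auto simp: mult.nonroot_def image_iff elim!: evenE)

lemma mult_noise_law_layer: "odd r \<Longrightarrow> mult.noise_law (r * 2 ^ i) = line.noise_law i"
  using mult_nonroot[of "r * 2 ^ i"]
  by (cases i) (auto simp: mult.noise_law_def line.noise_law_def line_nonroot Suc_leI odd_pos)

lemma mult_config_layer:
  assumes "odd r"
  shows "mult.config W (r * 2 ^ i) = line.config (\<lambda>i. W (r * 2 ^ i)) i"
proof (induction i)
  case 0
  then show ?case
    using assms mult_nonroot[of r] by (simp add: mult.config_root line.config_root line_nonroot odd_pos Suc_leI)
next
  case (Suc i)
  have "mult.config W (r * 2 ^ Suc i) = answer (W (r * 2 ^ Suc i)) (mult.config W (r * 2 ^ i))"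
    using mult.config_c[of "r * 2 ^ i" W] assms by (simp add: ac_simps Suc_leI odd_pos)
  then show ?case
    using Suc line.config_c[of i] by simp
qed

lemma layer_config_on:
  assumes "odd r"
  shows "layer r (mult.config_on W) = line.config_on (\<lambda>i\<in>{0..}. W (r * 2 ^ i))"
proof
  fix i
  have "1 \<le> r * 2 ^ i"
    using assms by (simp add: Suc_leI odd_pos)
  then show "layer r (mult.config_on W) i = line.config_on (\<lambda>i\<in>{0..}. W (r * 2 ^ i)) i"
    by (simp add: layer_def mult.config_on_def line.config_on_def mult_config_layer[OF assms] restrict_UNIV)
qed

end

lemma measurable_layer: "odd r \<Longrightarrow> layer r \<in> measurable (spin_algebra {Suc 0..}) (spin_algebra UNIV)"
  unfolding layer_def[abs_def] spin_algebra_def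
  by (rule measurable_PiM_single') (auto simp: space_PiM Suc_leI odd_pos PiE_iff intro!: measurable_component_singleton)

lemma measurable_mult_shift: "1 \<le> i \<Longrightarrow> mult_shift i \<in> measurable (spin_algebra {Suc 0..}) (spin_algebra {Suc 0..})"
  unfolding mult_shift_def[abs_def] spin_algebra_def One_nat_def
  by (rule measurable_restrict) (auto intro!: measurable_component_singleton)

context ising_kernel
begin

text \<open>Noise read along the sites \<open>r * 2 ^ i\<close> has exactly the law of the noise of
  the chain, by injective reindexing of a product measure, and the recursion for the spins along
  this half-line is that of the chain.\<close>

lemma distr_layer:
  assumes r: "odd r"
  shows "distr mult.gibbs (spin_algebra UNIV) (layer r) = line.gibbs"
proof -
  let ?f = "\<lambda>W. \<lambda>i\<in>{0..}. W (r * 2 ^ i)"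
  have f: "?f \<in> measurable mult.noise line.noise"
    unfolding line.noise_def mult.noise_def using r
    by (intro measurable_restrict) (auto simp: mult_noise_law_layer[symmetric] Suc_leI odd_pos intro!: measurable_component_singleton)
  have "inj_on (\<lambda>i. r * 2 ^ i) {0::nat..}"
    using r by (auto simp: inj_on_def odd_pos)
  then have "distr mult.noise (\<Pi>\<^sub>M i\<in>{0..}. measure_pmf (mult.noise_law (r * 2 ^ i))) ?f =
      (\<Pi>\<^sub>M i\<in>{0..}. measure_pmf (mult.noise_law (r * 2 ^ i)))"
    unfolding mult.noise_def using r
    by (intro distr_PiM_reindex) (auto simp: measure_pmf.prob_space_axioms Suc_leI odd_pos)
  then have noise: "distr mult.noise line.noise ?f = line.noise"
    by (simp only: mult_noise_law_layer[OF r] line.noise_def)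
  have "distr mult.gibbs (spin_algebra UNIV) (layer r) =
      distr mult.noise (spin_algebra UNIV) (layer r \<circ> mult.config_on)"
    unfolding mult.gibbs_def by (rule distr_distr[OF measurable_layer[OF r] mult.measurable_config_on])
  also have "\<dots> = distr mult.noise (spin_algebra UNIV) (line.config_on \<circ> ?f)"
    by (simp add: o_def layer_config_on[OF r])
  also have "\<dots> = distr (distr mult.noise line.noise ?f) (spin_algebra {0..}) line.config_on"
    using distr_distr[OF line.measurable_config_on f] by simp
  finally show ?thesis
    unfolding noise line.gibbs_def .
qed

text \<open>Layer \<open>r\<close> is a function of the noise on the block \<open>K r\<close>, and
  the blocks are disjoint. Independence on the noise space is carried over to \<open>gibbs\<close>
  through the joint law, which is a product on either side.\<close>

lemma indep_vars_layers:
  "prob_space.indep_vars mult.gibbs (\<lambda>_. spin_algebra UNIV) layer {r. odd r}"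
proof -
  interpret N: prob_space mult.noise by (rule mult.prob_space_noise)
  interpret G: prob_space mult.gibbs by (rule mult.prob_space_gibbs)
  define K where "K r = range (\<lambda>i. r * 2 ^ i)" for r :: nat
  let ?M = "\<lambda>j. measure_pmf (mult.noise_law j)"
  let ?Y = "\<lambda>r w. line.config_on (\<lambda>i\<in>{0..}. w (r * 2 ^ i))"
  have disj: "disjoint_family_on K {r. odd r}"
    by (auto simp: disjoint_family_on_def K_def dest: odd_mult_power2_inject)
  have Ksub: "K r \<subseteq> {Suc 0..}" if "odd r" for r
    using that by (auto simp: K_def Suc_leI odd_pos)
  have meas: "?Y r \<in> measurable (PiM (K r) ?M) (spin_algebra UNIV)" if r: "odd r" for r
  proof -
    have "(\<lambda>w. \<lambda>i\<in>{0..}. w (r * 2 ^ i)) \<in> measurable (PiM (K r) ?M) line.noise"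
      unfolding line.noise_def mult_noise_law_layer[OF r, symmetric]
      by (intro measurable_restrict measurable_component_singleton) (auto simp: K_def image_iff)
    then show ?thesis
      using measurable_compose[OF _ line.measurable_config_on] by simp
  qed
  have "N.indep_vars (\<lambda>r. PiM (K r) ?M) (\<lambda>r W. restrict (\<lambda>j. W j) (K r)) {r. odd r}"
    by (rule N.indep_vars_restrict[OF mult.indep_vars_noise _ disj]) (simp add: Ksub)
  then have ind0: "N.indep_vars (\<lambda>_. spin_algebra UNIV) (\<lambda>r W. ?Y r (restrict (\<lambda>j. W j) (K r))) {r. odd r}"
    by (rule N.indep_vars_compose2, intro meas) simp
  have eq: "(\<lambda>W. ?Y r (restrict (\<lambda>j. W j) (K r))) = (\<lambda>W. layer r (mult.config_on W))"
    if "r \<in> {r. odd r}" for r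
  proof -
    have "r * 2 ^ i \<in> K r" for i
      by (auto simp: K_def)
    then show ?thesis
      using that by (simp add: layer_config_on)
  qed
  have "N.indep_vars (\<lambda>_. spin_algebra UNIV) (\<lambda>r W. ?Y r (restrict (\<lambda>j. W j) (K r))) {r. odd r} \<longleftrightarrow>
      N.indep_vars (\<lambda>_. spin_algebra UNIV) (\<lambda>r W. layer r (mult.config_on W)) {r. odd r}"
    by (intro N.indep_vars_cong refl eq)
  then have ind: "N.indep_vars (\<lambda>_. spin_algebra UNIV) (\<lambda>r W. layer r (mult.config_on W)) {r. odd r}"
    using ind0 by (rule iffD1)
  have rv: "(\<lambda>W. layer r (mult.config_on W)) \<in> measurable mult.noise (spin_algebra UNIV)" if "odd r" for r
    by (rule measurable_compose[OF mult.measurable_config_on measurable_layer[OF that]])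
  have rv': "layer r \<in> measurable mult.gibbs (spin_algebra UNIV)" if "odd r" for r
    using measurable_layer[OF that] by (simp add: mult.gibbs_def)
  have ne: "{r::nat. odd r} \<noteq> {}"
    using odd_one by blast
  have all: "(\<lambda>\<sigma>. \<lambda>r\<in>{r. odd r}. layer r \<sigma>) \<in> measurable (spin_algebra {Suc 0..}) (\<Pi>\<^sub>M r\<in>{r. odd r}. spin_algebra UNIV)"
    by (intro measurable_restrict) (simp add: measurable_layer)
  have "distr mult.gibbs (\<Pi>\<^sub>M r\<in>{r. odd r}. spin_algebra UNIV) (\<lambda>\<sigma>. \<lambda>r\<in>{r. odd r}. layer r \<sigma>) =
      distr mult.noise (\<Pi>\<^sub>M r\<in>{r. odd r}. spin_algebra UNIV) (\<lambda>W. \<lambda>r\<in>{r. odd r}. layer r (mult.config_on W))"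
    unfolding mult.gibbs_def by (subst distr_distr[OF all mult.measurable_config_on]) (simp add: o_def)
  also have "\<dots> = (\<Pi>\<^sub>M r\<in>{r. odd r}. distr mult.noise (spin_algebra UNIV) (\<lambda>W. layer r (mult.config_on W)))"
    by (rule N.indep_vars_iff_distr_eq_PiM'[OF ne, THEN iffD1]) (use ind rv in simp_all)
  also have "\<dots> = (\<Pi>\<^sub>M r\<in>{r. odd r}. distr mult.gibbs (spin_algebra UNIV) (layer r))"
    unfolding mult.gibbs_def
    by (intro PiM_cong refl) (simp add: distr_distr[OF measurable_layer mult.measurable_config_on] o_def)
  finally show ?thesis
    by (intro G.indep_vars_iff_distr_eq_PiM'[OF ne, THEN iffD2]) (use rv' in auto)
qed

end

subsection \<open>Multiplication invariance\<close>

context spin_forest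
begin

text \<open>The noise takes four values, so any event of the pair is a finite disjoint union of
  rectangles, whose masses are products. It serves to merge the noises of a root and its
  child.\<close>

lemma distr_noise_pair:
  assumes ij: "a \<le> i" "a \<le> j" "i \<noteq> j"
    and g: "(\<lambda>W. g (W i) (W j)) \<in> measurable noise (count_space UNIV)"
  shows "distr noise (count_space UNIV) (\<lambda>W. g (W i) (W j)) =
    measure_pmf (map_pmf (\<lambda>(u, v). g u v) (pair_pmf (noise_law i) (noise_law j)))"
proof (rule measure_eqI)
  fix A assume "A \<in> sets (distr noise (count_space UNIV) (\<lambda>W. g (W i) (W j)))"
  define S where "S = {p. g (fst p) (snd p) \<in> A}"
  let ?E = "\<lambda>p. {W \<in> space noise. \<forall>k\<in>{i, j}. W k \<in> (if k = i then {fst p} else {snd p})}"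
  have meas: "?E p \<in> sets noise" for p
    unfolding noise_def using ij
    by (intro sets.sets_Collect_finite_All sets_Collect_single) auto
  have "emeasure (distr noise (count_space UNIV) (\<lambda>W. g (W i) (W j))) A =
      emeasure noise (\<Union>p\<in>S. ?E p)"
    using g ij by (subst emeasure_distr) (auto simp: S_def intro!: arg_cong[where f = "emeasure noise"], metis surj_pair)
  also have "\<dots> = (\<Sum>p\<in>S. emeasure noise (?E p))"
    using meas ij by (intro sum_emeasure[symmetric]) (auto simp: disjoint_family_on_def prod_eq_iff)
  also have "\<dots> = (\<Sum>p\<in>S. ennreal (pmf (pair_pmf (noise_law i) (noise_law j)) p))"
  proof (intro sum.cong refl)
    fix p
    have "emeasure noise (?E p) =
        (\<Prod>k\<in>{i, j}. emeasure (measure_pmf (noise_law k)) (if k = i then {fst p} else {snd p}))"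
      unfolding noise_def using ij by (intro noise.emeasure_PiM_Collect) auto
    also have "\<dots> = ennreal (pmf (pair_pmf (noise_law i) (noise_law j)) p)"
      using ij by (cases p) (simp add: emeasure_pmf_single pmf_pair ennreal_mult)
    finally show "emeasure noise (?E p) = ennreal (pmf (pair_pmf (noise_law i) (noise_law j)) p)" .
  qed
  also have "\<dots> = emeasure (measure_pmf (pair_pmf (noise_law i) (noise_law j))) S"
    by (simp add: emeasure_measure_pmf_finite)
  finally show "emeasure (distr noise (count_space UNIV) (\<lambda>W. g (W i) (W j))) A =
      emeasure (measure_pmf (map_pmf (\<lambda>(u, v). g u v) (pair_pmf (noise_law i) (noise_law j)))) A"
    by (simp add: S_def vimage_def case_prod_unfold)
qed simp

end

context ising_kernel
begin

text \<open>Multiplication by an odd number preserves parity and commutes with doubling. It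
  therefore maps roots to roots and children to children, and the relabelled noise has the same law
  and drives the shifted configuration; the field may be arbitrary here.\<close>

lemma distr_mult_shift_odd:
  assumes i: "odd i"
  shows "distr mult.gibbs (spin_algebra {Suc 0..}) (mult_shift i) = mult.gibbs"
proof -
  let ?f = "\<lambda>W. \<lambda>j\<in>{Suc 0..}. W (i * j)"
  have ij: "Suc 0 \<le> i * j" if "Suc 0 \<le> j" for j
    using i that by (simp add: Suc_le_eq odd_pos)
  have law: "mult.noise_law (i * j) = mult.noise_law j" if "j \<in> {Suc 0..}" for j
    using that i ij[of j] by (simp add: mult.noise_law_def mult_nonroot)
  have P: "(\<Pi>\<^sub>M j\<in>{Suc 0..}. measure_pmf (mult.noise_law (i * j))) = mult.noise"
    unfolding mult.noise_def by (intro PiM_cong refl) (simp add: law)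
  have "distr mult.noise (\<Pi>\<^sub>M j\<in>{Suc 0..}. measure_pmf (mult.noise_law (i * j))) ?f =
      (\<Pi>\<^sub>M j\<in>{Suc 0..}. measure_pmf (mult.noise_law (i * j)))"
    unfolding mult.noise_def using i ij
    by (intro distr_PiM_reindex) (auto simp: measure_pmf.prob_space_axioms inj_on_def odd_pos)
  then have noise: "distr mult.noise mult.noise ?f = mult.noise"
    by (simp only: P)
  have f: "?f \<in> measurable mult.noise mult.noise"
  proof -
    have "?f \<in> measurable mult.noise (\<Pi>\<^sub>M j\<in>{Suc 0..}. measure_pmf (mult.noise_law (i * j)))"
      unfolding mult.noise_def using ij by (intro measurable_restrict measurable_component_singleton) auto
    then show ?thesis by (simp only: P)
  qed
  have config: "mult.config W (i * j) = mult.config V j"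
    if V: "\<And>k. Suc 0 \<le> k \<Longrightarrow> V k = W (i * k)" and "Suc 0 \<le> j" for W V j
    using that(2)
  proof (induction j rule: less_induct)
    case (less j)
    show ?case
    proof (cases "even j")
      case True
      then obtain k where k: "j = 2 * k" by (elim evenE)
      have "mult.config W (2 * (i * k)) = answer (W (2 * (i * k))) (mult.config W (i * k))"
        using less.prems k ij[of k] by (intro mult.config_c) auto
      moreover have "mult.config W (i * k) = mult.config V k"
        by (rule less.IH) (use k less.prems in auto)
      moreover have "2 * (i * k) = i * j"
        by (simp add: k)
      ultimately show ?thesis
        using less.prems k mult.config_c[of k V] by (simp add: V)
    next
      case False
      then show ?thesis
        using i ij[OF less.prems] less.prems by (simp add: mult.config_root mult_nonroot V)
    qed
  qed
  have config_f: "mult.config W (i * j) = mult.config (?f W) j" if "Suc 0 \<le> j" for W j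
    by (rule config) (use that in simp_all)
  have "distr mult.gibbs (spin_algebra {Suc 0..}) (mult_shift i) =
      distr mult.noise (spin_algebra {Suc 0..}) (mult_shift i \<circ> mult.config_on)"
    unfolding mult.gibbs_def using i
    by (intro distr_distr measurable_mult_shift mult.measurable_config_on) (auto simp: Suc_le_eq odd_pos)
  also have "mult_shift i \<circ> mult.config_on = mult.config_on \<circ> ?f"
    using ij by (auto simp: fun_eq_iff mult_shift_def mult.config_on_def config_f)
  also have "distr mult.noise (spin_algebra {Suc 0..}) (mult.config_on \<circ> ?f) =
      distr (distr mult.noise mult.noise ?f) (spin_algebra {Suc 0..}) mult.config_on"
    by (rule distr_distr[symmetric, OF mult.measurable_config_on f])
  finally show ?thesis
    unfolding noise mult.gibbs_def .
qed

text \<open>Zero field makes the root law stationary for the kernel.\<close>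

lemma bind_root_child:
  assumes "h = 0"
  shows "map_pmf (\<lambda>(u, v). let b = if fst u then fst v else snd v in (b, b)) (pair_pmf root_noise child_noise) =
    root_noise"
proof -
  \<comment> \<open>Without field the eigenvalue equations reduce to
    \<open>t * t = 1\<close>.\<close>
  have "exp J * t + exp (- J) = (exp (- J) * t + exp J) * t"
    using eigen_plus unfolding eigen_minus[symmetric] by (simp add: assms)
  then have "exp (- J) * ((t - 1) * (t + 1)) = 0"
    by (simp add: algebra_simps)
  then have "(t - 1) * (t + 1) = 0" by simp
  then have t: "t = 1" using t_pos by simp
  have start: "start 1 = 1 / 2"
    unfolding start_def eigvec_def using assms t by simp
  \<comment> \<open>The matrix is doubly stochastic, so the uniform law, which is
    \<open>start\<close> here, is stationary.\<close>
  have kern: "kern 1 1 + kern (-1) 1 = 1"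
    using kern_sum[of 1] unfolding kern_def eigvec_def using assms t by simp
  have range: "0 \<le> kern 1 1" "kern 1 1 \<le> 1" "0 \<le> kern (-1) 1" "kern (-1) 1 \<le> 1"
    using kern_le_1[of 1 1] kern_le_1[of 1 "-1"] kern_pos[of 1 1] kern_pos[of "-1" 1] by auto
  have "map_pmf (\<lambda>(u, v). let b = if fst u then fst v else snd v in (b, b)) (pair_pmf root_noise child_noise) =
      map_pmf (\<lambda>b. (b, b)) (bind_pmf (bernoulli_pmf (1 / 2)) (\<lambda>x.
        map_pmf (\<lambda>v. if x then fst v else snd v) child_noise))"
    by (simp add: pair_pmf_def root_noise_def start map_pmf_def bind_assoc_pmf bind_return_pmf Let_def)
  also have "bind_pmf (bernoulli_pmf (1 / 2)) (\<lambda>x. map_pmf (\<lambda>v. if x then fst v else snd v) child_noise) =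
      bind_pmf (bernoulli_pmf (1 / 2)) (\<lambda>x. bernoulli_pmf (if x then kern 1 1 else kern (-1) 1))"
    by (intro bind_pmf_cong refl) (simp add: child_noise_def map_fst_pair_pmf map_snd_pair_pmf)
  also have "\<dots> = bernoulli_pmf (1 / 2)"
  proof (rule pmf_eqI)
    show "pmf (bind_pmf (bernoulli_pmf (1 / 2)) (\<lambda>x. bernoulli_pmf (if x then kern 1 1 else kern (-1) 1))) b =
        pmf (bernoulli_pmf (1 / 2)) b" for b
      using range kern by (cases b) (simp_all add: pmf_bind field_simps)
  qed
  finally show ?thesis
    by (simp add: root_noise_def start)
qed

text \<open>Doubling turns even sites into children again, but odd sites, which are roots, into
  children of roots. Stationarity restores the root law at these sites, so the modified noise
  \<open>X\<close> has the law of the original one.\<close>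

lemma distr_mult_shift_2:
  assumes "h = 0"
  shows "distr mult.gibbs (spin_algebra {Suc 0..}) (mult_shift 2) = mult.gibbs"
proof -
  interpret N: prob_space mult.noise by (rule mult.prob_space_noise)
  let ?M = "\<lambda>j. measure_pmf (mult.noise_law j)"
  let ?g = "\<lambda>u v. let b = if fst u then fst v else snd v in (b, b :: bool)"
  \<comment> \<open>noise driving the shifted configuration: odd sites become roots, so the noises at \<open>j\<close> and \<open>2 * j\<close>
    merge into one root noise\<close>
  define X :: "nat \<Rightarrow> (nat \<Rightarrow> bool \<times> bool) \<Rightarrow> bool \<times> bool"
    where "X j W = (if odd j then ?g (W j) (W (2 * j)) else W (2 * j))" for j W
  \<comment> \<open>The sites whose noise \<open>X j\<close> reads. Every even site occurs in the
    block of its half only and every odd site in its own, so the blocks are disjoint and the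
    \<open>X j\<close> independent.\<close>
  define K :: "nat \<Rightarrow> nat set" where "K j = (if odd j then {j, 2 * j} else {2 * j})" for j
  have disj: "disjoint_family_on K {Suc 0..}"
    unfolding disjoint_family_on_def K_def by (auto split: if_splits)
  have comp: "(\<lambda>w. w k) \<in> measurable (PiM (K j) ?M) (count_space UNIV)" if "k \<in> K j" for j k
    using measurable_component_singleton[OF that, of ?M]
    by (subst measurable_cong_sets[OF refl, of _ "measure_pmf (mult.noise_law k)"]) simp_all
  have X_meas: "X j \<in> measurable (PiM (K j) ?M) (measure_pmf (mult.noise_law j))" for j
  proof (cases "odd j")
    case True
    then have K: "j \<in> K j" "2 * j \<in> K j" by (auto simp: K_def)
    have "(\<lambda>w. ?g (w j) (w (2 * j))) \<in> measurable (PiM (K j) ?M) (count_space UNIV)"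
      by (rule measurable_compose_countable[OF _ comp[OF K(1)]], rule measurable_compose[OF comp[OF K(2)]]) simp
    moreover have "X j = (\<lambda>w. ?g (w j) (w (2 * j)))"
      using True by (simp add: X_def fun_eq_iff)
    ultimately show ?thesis
      by (subst measurable_cong_sets[OF refl, of _ "count_space UNIV"]) simp_all
  next
    case False
    moreover from False have "2 * j \<in> K j" by (auto simp: K_def)
    ultimately show ?thesis
      using comp[of "2 * j" j]
      by (subst measurable_cong_sets[OF refl, of _ "count_space UNIV"]) (simp_all add: X_def[abs_def])
  qed
  have XK: "X j (restrict W (K j)) = X j W" for j W
    by (simp add: X_def K_def)
  have "N.indep_vars (\<lambda>j. PiM (K j) ?M) (\<lambda>j W. restrict (\<lambda>j. W j) (K j)) {Suc 0..}"
    by (rule N.indep_vars_restrict[OF mult.indep_vars_noise _ disj]) (auto simp: K_def)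
  then have "N.indep_vars ?M (\<lambda>j W. X j (restrict (\<lambda>j. W j) (K j))) {Suc 0..}"
    by (rule N.indep_vars_compose2, intro X_meas)
  then have indep: "N.indep_vars ?M X {Suc 0..}"
    by (simp only: XK)
  have X_rv: "X j \<in> measurable mult.noise (measure_pmf (mult.noise_law j))" if "Suc 0 \<le> j" for j
    using indep that by (simp add: N.indep_vars_def)
  have X_law: "distr mult.noise (measure_pmf (mult.noise_law j)) (X j) = measure_pmf (mult.noise_law j)"
    if j: "Suc 0 \<le> j" for j
  proof (cases "odd j")
    case True
    have X: "X j = (\<lambda>W. ?g (W j) (W (2 * j)))"
      using True by (simp add: X_def fun_eq_iff)
    have law: "mult.noise_law j = root_noise" "mult.noise_law (2 * j) = child_noise"
      using True j by (simp_all add: mult.noise_law_def mult_nonroot)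
    have "X j \<in> measurable mult.noise (count_space UNIV)"
      using X_rv[OF j] by (subst measurable_cong_sets[OF refl, of _ "measure_pmf (mult.noise_law j)"]) simp_all
    then have "distr mult.noise (count_space UNIV) (\<lambda>W. ?g (W j) (W (2 * j))) =
        measure_pmf (map_pmf (\<lambda>(u, v). ?g u v) (pair_pmf (mult.noise_law j) (mult.noise_law (2 * j))))"
      unfolding X using j by (intro mult.distr_noise_pair) simp_all
    also have "\<dots> = measure_pmf root_noise"
      by (simp only: law bind_root_child[OF assms])
    finally have "distr mult.noise (count_space UNIV) (X j) = measure_pmf root_noise"
      by (simp only: X)
    moreover have "distr mult.noise (measure_pmf (mult.noise_law j)) (X j) =
        distr mult.noise (count_space UNIV) (X j)"
      by (intro distr_cong) simp_all
    ultimately show ?thesis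
      by (simp only: law)
  next
    case False
    have law: "mult.noise_law (2 * j) = mult.noise_law j"
      using False j by (simp add: mult.noise_law_def mult_nonroot)
    have "X j = (\<lambda>W. W (2 * j))"
      using False by (simp add: X_def fun_eq_iff)
    moreover have "distr mult.noise (measure_pmf (mult.noise_law (2 * j))) (\<lambda>W. W (2 * j)) =
        measure_pmf (mult.noise_law (2 * j))"
      unfolding mult.noise_def using j by (intro mult.noise.PiM_component) auto
    ultimately show ?thesis
      by (simp only: law)
  qed
  let ?f = "\<lambda>W. \<lambda>j\<in>{Suc 0..}. X j W"
  have P: "(\<Pi>\<^sub>M j\<in>{Suc 0..}. ?M j) = mult.noise"
    by (simp only: mult.noise_def)
  have "distr mult.noise (\<Pi>\<^sub>M j\<in>{Suc 0..}. ?M j) ?f = (\<Pi>\<^sub>M j\<in>{Suc 0..}. distr mult.noise (?M j) (X j))"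
    by (rule N.indep_vars_iff_distr_eq_PiM'[THEN iffD1]) (use indep X_rv in simp_all)
  also have "\<dots> = (\<Pi>\<^sub>M j\<in>{Suc 0..}. ?M j)"
    by (intro PiM_cong refl X_law) simp
  finally have noise: "distr mult.noise mult.noise ?f = mult.noise"
    unfolding P .
  have "?f \<in> measurable mult.noise (\<Pi>\<^sub>M j\<in>{Suc 0..}. ?M j)"
    by (intro measurable_restrict X_rv) simp
  then have f: "?f \<in> measurable mult.noise mult.noise"
    unfolding P .
  have config: "mult.config W (2 * j) = mult.config V j"
    if V: "\<And>k. Suc 0 \<le> k \<Longrightarrow> V k = X k W" and "Suc 0 \<le> j" for W V j
    using that(2)
  proof (induction j rule: less_induct)
    case (less j)
    have *: "mult.config W (2 * j) = answer (W (2 * j)) (mult.config W j)"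
      using less.prems by (rule mult.config_c)
    show ?case
    proof (cases "even j")
      case True
      then obtain k where k: "j = 2 * k" by (elim evenE)
      then show ?thesis
        using * less mult.config_c[of k V] by (simp add: V X_def)
    next
      \<comment> \<open>A root answers to the virtual parent spin 1, that is by its first component;
        this is why the merged noise tests \<open>fst u\<close>.\<close>
      case False
      then show ?thesis
        using * less.prems by (simp add: mult.config_root mult_nonroot V X_def answer_def spin_def Let_def)
    qed
  qed
  have config_f: "mult.config W (2 * j) = mult.config (?f W) j" if "Suc 0 \<le> j" for W j
    by (rule config) (use that in simp_all)
  have "distr mult.gibbs (spin_algebra {Suc 0..}) (mult_shift 2) =
      distr mult.noise (spin_algebra {Suc 0..}) (mult_shift 2 \<circ> mult.config_on)"
    unfolding mult.gibbs_def
    by (intro distr_distr measurable_mult_shift mult.measurable_config_on) simp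
  also have "mult_shift 2 \<circ> mult.config_on = mult.config_on \<circ> ?f"
    by (auto simp: fun_eq_iff mult_shift_def mult.config_on_def config_f)
  also have "distr mult.noise (spin_algebra {Suc 0..}) (mult.config_on \<circ> ?f) =
      distr (distr mult.noise mult.noise ?f) (spin_algebra {Suc 0..}) mult.config_on"
    by (rule distr_distr[symmetric, OF mult.measurable_config_on f])
  finally show ?thesis
    unfolding noise mult.gibbs_def .
qed

text \<open>Shifts compose multiplicatively, so factors 2 are stripped off until an odd shift is
  left.\<close>

lemma distr_mult_shift:
  assumes "h = 0" "Suc 0 \<le> i"
  shows "distr mult.gibbs (spin_algebra {Suc 0..}) (mult_shift i) = mult.gibbs"
  using assms(2)
proof (induction i rule: less_induct)
  case (less i)
  show ?case
  proof (cases "odd i")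
    case False
    then obtain k where k: "i = 2 * k" "Suc 0 \<le> k" "k < i"
      using less.prems by (auto elim!: evenE)
    have "mult_shift k \<circ> mult_shift 2 = mult_shift i"
      using k by (auto simp: fun_eq_iff mult_shift_def restrict_def Suc_le_eq mult.assoc)
    then have "distr mult.gibbs (spin_algebra {Suc 0..}) (mult_shift i) =
        distr (distr mult.gibbs (spin_algebra {Suc 0..}) (mult_shift 2)) (spin_algebra {Suc 0..}) (mult_shift k)"
      using k by (subst distr_distr) (auto simp: mult.gibbs_def intro: measurable_mult_shift)
    then show ?thesis
      using less.IH[OF k(3,2)] by (simp add: distr_mult_shift_2[OF assms(1)])
  qed (rule distr_mult_shift_odd)
qed

end

subsection \<open>The multiplicative potential\<close>

locale mult_ising = ising_kernel "\<beta> * J" "\<beta> * h" t lam for \<beta> J h t lam :: real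
begin

text \<open>The sites 0 to N form the volume of size \<open>Suc N\<close>, whose boundary is the
  single site N. The right boundary spin of either sign is a bounded positive weight there, so both
  signs give the same limit.\<close>

lemma is_standard_ising_line: "is_standard_ising \<beta> J h line.gibbs"
  unfolding is_standard_ising_def
proof
  fix s :: real assume "s \<in> {-1, 1}"
  have "exp (\<beta> * s * x) \<in> {exp (- \<bar>\<beta> * s\<bar>)..exp \<bar>\<beta> * s\<bar>}" if "x \<in> {-1, 1}" for x
    using that by auto
  moreover have "exp (- (- \<beta> * ((\<Sum>i<N. J * \<omega> i * \<omega> (i + 1)) + (\<Sum>i=0..N. h * \<omega> i) + s * \<omega> N))) =
      exp (line.energy (Suc N) \<omega>) * (\<Prod>i\<in>line.bd (Suc N). exp (\<beta> * s * \<omega> i))" for N \<omega>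
  proof -
    have sets: "{i \<in> {0..<Suc N}. Suc i < Suc N} = {..<N}" "line.bd (Suc N) = {N}"
      and ivl: "{0..<Suc N} = {0..N}"
      by (auto simp: line.bd_def)
    have "line.energy (Suc N) \<omega> + \<beta> * s * \<omega> N =
        \<beta> * ((\<Sum>i<N. J * \<omega> i * \<omega> (i + 1)) + (\<Sum>i=0..N. h * \<omega> i) + s * \<omega> N)"
      unfolding line.energy_def sets unfolding ivl
      by (simp add: sum_distrib_left distrib_left mult_ac)
    then show ?thesis
      by (simp add: sets exp_add[symmetric])
  qed
  ultimately have "cylinder_limit {0..} (\<lambda>N. boltzmann_measure {0..<Suc N}
      (\<lambda>\<omega>. - \<beta> * ((\<Sum>i<N. J * \<omega> i * \<omega> (i + 1)) + (\<Sum>i=0..N. h * \<omega> i) + s * \<omega> N))) line.gibbs"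
    by (intro line.cylinder_limit_gibbs[where e = "\<lambda>i x. exp (\<beta> * s * x)" and lo = "exp (- \<bar>\<beta> * s\<bar>)"
        and hi = "exp \<bar>\<beta> * s\<bar>"] filterlim_Suc) auto
  moreover have "{0..<Suc N} = {0..N}" for N by auto
  ultimately show "cylinder_limit UNIV (ising_finite \<beta> J h s) line.gibbs"
    by (simp add: ising_finite_def[abs_def])
qed

text \<open>The sites 1 to 2N form the volume of size \<open>Suc (2 * N)\<close>. Its boundary is N
  + 1 to 2N, where the outer spins act as a local weight.\<close>

lemma mult_hamiltonian_eq_energy:
  "exp (- mult_hamiltonian \<beta> J h N \<eta> \<omega>) =
    exp (mult.energy (Suc (2 * N)) \<omega>) * (\<Prod>i\<in>mult.bd (Suc (2 * N)). exp (\<beta> * J * \<eta> (2 * i) * \<omega> i))"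
proof -
  have sets: "{i \<in> {Suc 0..<Suc (2 * N)}. 2 * i < Suc (2 * N)} = {1..N}"
    and bd: "mult.bd (Suc (2 * N)) = {N + 1..2 * N}" and ivl: "{Suc 0..<Suc (2 * N)} = {1..2 * N}"
    by (auto simp: mult.bd_def)
  have "mult.energy (Suc (2 * N)) \<omega> + (\<Sum>i=N + 1..2 * N. \<beta> * J * \<eta> (2 * i) * \<omega> i) =
      \<beta> * ((\<Sum>i=1..N. J * \<omega> i * \<omega> (2 * i)) + (\<Sum>i=1..2 * N. h * \<omega> i) +
        (\<Sum>i=N + 1..2 * N. J * \<omega> i * \<eta> (2 * i)))"
    unfolding mult.energy_def sets unfolding ivl
    by (simp add: sum_distrib_left distrib_left mult_ac)
  then show ?thesis
    unfolding mult_hamiltonian_def bd by (simp add: exp_sum[symmetric] exp_add[symmetric])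
qed

lemma boundary_weight_bounds:
  "\<eta> \<in> spin_configs {1..} \<Longrightarrow> Suc 0 \<le> i \<Longrightarrow> x \<in> {-1, 1} \<Longrightarrow>
    exp (\<beta> * J * \<eta> (2 * i) * x) \<in> {exp (- \<bar>\<beta> * J\<bar>)..exp \<bar>\<beta> * J\<bar>}"
  using spin_configsD[of \<eta> "{1..}" "2 * i"] by auto

lemma filterlim_volume: "filterlim (\<lambda>N. Suc (2 * N)) at_top sequentially"
  by (rule filterlim_subseq) (simp add: strict_mono_def)

lemma volume_eq: "{1..2 * N} = {Suc 0..<Suc (2 * N)}"
  by auto

lemma cylinder_limit_mult:
  assumes "\<eta> \<in> spin_configs {1..}"
  shows "cylinder_limit {Suc 0..} (\<lambda>N. mult_ising_finite \<beta> J h N \<eta>) mult.gibbs"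
  unfolding mult_ising_finite_def volume_eq
  by (rule mult.cylinder_limit_gibbs[where e = "\<lambda>i x. exp (\<beta> * J * \<eta> (2 * i) * x)"
        and H = "\<lambda>N. mult_hamiltonian \<beta> J h N \<eta>" and N = "\<lambda>N. Suc (2 * N)", OF _ boundary_weight_bounds[OF assms] mult_hamiltonian_eq_energy filterlim_volume])
    auto

lemma mult_cylinder_tendsto:
  assumes "\<eta> \<in> spin_configs {1..}" "Suc 0 \<le> m" "\<zeta> \<in> spin_configs {Suc 0..<m}"
  shows "(\<lambda>N. measure (mult_ising_finite \<beta> J h N \<eta>)
      {\<omega> \<in> spin_configs {1..2 * N}. restrict \<omega> {Suc 0..<m} = \<zeta>}) \<longlonglongrightarrow> mult.cyl_prob m \<zeta>"
  unfolding mult_ising_finite_def volume_eq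
  by (rule mult.boltzmann_cylinder_tendsto[where e = "\<lambda>i x. exp (\<beta> * J * \<eta> (2 * i) * x)"
        and H = "\<lambda>N. mult_hamiltonian \<beta> J h N \<eta>" and N = "\<lambda>N. Suc (2 * N)", OF _ boundary_weight_bounds[OF assms(1)]
        mult_hamiltonian_eq_energy filterlim_volume assms(2,3)]) auto

end

section \<open>Energies and kernels of the potential\<close>

definition touching :: "nat set \<Rightarrow> nat set" where
  "touching \<Lambda> = {i. 1 \<le> i \<and> (i \<in> \<Lambda> \<or> 2 * i \<in> \<Lambda>)}"

lemma finite_touching:
  assumes "finite \<Lambda>"
  shows "finite (touching \<Lambda>)"
proof -
  have "touching \<Lambda> \<subseteq> \<Lambda> \<union> (\<lambda>j. j div 2) ` \<Lambda>"
    by (force simp: touching_def)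
  then show ?thesis
    using assms by (auto intro: finite_subset)
qed

text \<open>Only singletons in \<Lambda> and bonds meeting \<Lambda> contribute, so the infinite sum
  is finite. A bond is indexed by its lower endpoint, which is what \<open>touching\<close>
  collects.\<close>

lemma gibbs_energy_mult_potential:
  assumes \<Lambda>: "finite \<Lambda>" "\<Lambda> \<subseteq> {1..}" and \<sigma>: "\<sigma> = merge \<Lambda> ({1..} - \<Lambda>) (\<omega>, \<eta>)"
  shows "gibbs_energy (mult_potential \<beta> J h) \<Lambda> \<omega> \<eta> =
    - ((\<Sum>i\<in>\<Lambda>. \<beta> * h * \<sigma> i) + (\<Sum>i\<in>touching \<Lambda>. \<beta> * J * \<sigma> i * \<sigma> (2 * i)))"
proof -
  let ?S1 = "(\<lambda>i. {i}) ` \<Lambda>" and ?S2 = "(\<lambda>i. {i, 2 * i}) ` touching \<Lambda>"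
  let ?U = "\<lambda>A. mult_potential \<beta> J h A \<sigma>"
  have fin: "finite (?S1 \<union> ?S2)"
    using \<Lambda> finite_touching by auto
  have disj: "?S1 \<inter> ?S2 = {}"
    by (auto simp: touching_def)
  have inj2: "inj_on (\<lambda>i. {i, 2 * i}) (touching \<Lambda>)"
    by (auto simp: inj_on_def doubleton_eq_iff touching_def)
  have "gibbs_energy (mult_potential \<beta> J h) \<Lambda> \<omega> \<eta> = infsum ?U (?S1 \<union> ?S2)"
    unfolding gibbs_energy_def \<sigma>[symmetric]
  proof (rule infsum_cong_neutral)
    fix A assume "A \<in> {A. finite A \<and> A \<subseteq> {1..} \<and> A \<inter> \<Lambda> \<noteq> {}} - (?S1 \<union> ?S2)"
    then show "?U A = 0"
      by (intro mult_potential_other) (auto simp: touching_def image_iff)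
  qed (use \<Lambda> in \<open>auto simp: touching_def\<close>)
  also have "\<dots> = sum ?U ?S1 + sum ?U ?S2"
    using fin disj by (simp add: sum.union_disjoint)
  also have "sum ?U ?S1 = (\<Sum>i\<in>\<Lambda>. - \<beta> * h * \<sigma> i)"
    by (subst sum.reindex) (auto simp: mult_potential_singleton inj_on_def)
  also have "sum ?U ?S2 = (\<Sum>i\<in>touching \<Lambda>. - J * \<beta> * \<sigma> i * \<sigma> (2 * i))"
    by (subst sum.reindex[OF inj2]) (auto simp: mult_potential_pair touching_def intro!: sum.cong)
  finally show ?thesis
    by (simp add: sum_negf mult_ac)
qed

lemma gibbs_kernel_bounds:
  assumes "finite \<Lambda>" "\<omega> \<in> spin_configs \<Lambda>"
  shows "0 \<le> gibbs_kernel U \<Lambda> \<omega> \<eta>" "gibbs_kernel U \<Lambda> \<omega> \<eta> \<le> 1"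
proof -
  have le: "exp (- gibbs_energy U \<Lambda> \<omega> \<eta>) \<le> (\<Sum>\<omega>'\<in>spin_configs \<Lambda>. exp (- gibbs_energy U \<Lambda> \<omega>' \<eta>))"
    using assms finite_spin_configs by (intro member_le_sum) auto
  have pos: "0 < (\<Sum>\<omega>'\<in>spin_configs \<Lambda>. exp (- gibbs_energy U \<Lambda> \<omega>' \<eta>))"
    using assms by (intro sum_pos finite_spin_configs) auto
  show "0 \<le> gibbs_kernel U \<Lambda> \<omega> \<eta>" "gibbs_kernel U \<Lambda> \<omega> \<eta> \<le> 1"
    unfolding gibbs_kernel_def using le pos by auto
qed

section \<open>The algebra of the outer spins\<close>

lemma space_outside_algebra: "space (outside_algebra \<Lambda>) = spin_configs {1..}"
  by (simp add: outside_algebra_def space_spin_algebra)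

lemma restrict_outside_measurable:
  "(\<lambda>\<sigma>. restrict \<sigma> ({1..} - \<Lambda>)) \<in> measurable (outside_algebra \<Lambda>) (spin_algebra ({1..} - \<Lambda>))"
  unfolding outside_algebra_def
  by (rule measurable_vimage_algebra1) (auto simp: space_spin_algebra intro: restrict_spin_configs)

lemma subalgebra_outside_algebra:
  assumes "sets \<mu> = sets (spin_algebra {1..})"
  shows "subalgebra \<mu> (outside_algebra \<Lambda>)"
proof -
  have meas: "(\<lambda>\<sigma>. restrict \<sigma> ({1..} - \<Lambda>)) \<in> measurable (spin_algebra {1..}) (spin_algebra ({1..} - \<Lambda>))"
    by (rule measurable_restrict_spin) auto
  have "sets (outside_algebra \<Lambda>) \<subseteq> sets (spin_algebra {1..})"
    unfolding outside_algebra_def using measurable_sets[OF meas]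
    by (subst sets_vimage_algebra2) (use measurable_space[OF meas] in auto)
  then show ?thesis
    using assms sets_eq_imp_space_eq[OF assms]
    by (simp add: subalgebra_def space_outside_algebra space_spin_algebra)
qed

text \<open>The energy is a polynomial in finitely many merged spins, and a merged spin is either an
  outer spin or a constant.\<close>

lemma gibbs_kernel_measurable:
  assumes \<Lambda>: "finite \<Lambda>" "\<Lambda> \<subseteq> {1..}"
  shows "gibbs_kernel (mult_potential \<beta> J h) \<Lambda> \<omega> \<in> borel_measurable (outside_algebra \<Lambda>)"
proof -
  have coord: "(\<lambda>\<eta>. merge \<Lambda> ({1..} - \<Lambda>) (\<omega>', \<eta>) i) \<in> borel_measurable (outside_algebra \<Lambda>)" for \<omega>' i
  proof (cases "i \<in> {1..} - \<Lambda>")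
    case True
    then have "(\<lambda>\<eta>. (restrict \<eta> ({1..} - \<Lambda>)) i) \<in> borel_measurable (outside_algebra \<Lambda>)"
      by (intro measurable_compose[OF restrict_outside_measurable measurable_spin_borel])
    then show ?thesis
      using True by (simp add: merge_def)
  next
    case False
    then have "(\<lambda>\<eta>. merge \<Lambda> ({1..} - \<Lambda>) (\<omega>', \<eta>) i) = (\<lambda>_. if i \<in> \<Lambda> then \<omega>' i else undefined)"
      by (auto simp: merge_def)
    then show ?thesis
      by simp
  qed
  show ?thesis
    unfolding gibbs_kernel_def[abs_def] gibbs_energy_mult_potential[OF \<Lambda> refl]
    using coord by measurable
qed

subsection \<open>The Gibbs property and uniqueness\<close>

lemma restrict_eq_merge_iff:
  assumes "\<omega> \<in> spin_configs A" "\<zeta> \<in> spin_configs B" "A \<inter> B = {}"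
  shows "restrict \<sigma> A = \<omega> \<and> restrict \<sigma> B = \<zeta> \<longleftrightarrow> restrict \<sigma> (A \<union> B) = merge A B (\<omega>, \<zeta>)"
proof -
  have "\<omega> x = undefined" if "x \<notin> A" for x
    using assms(1) that by (auto simp: spin_configs_def)
  moreover have "\<zeta> x = undefined" if "x \<notin> B" for x
    using assms(2) that by (auto simp: spin_configs_def)
  ultimately show ?thesis
    using assms(3) unfolding fun_eq_iff restrict_def merge_def by (auto split: if_splits; metis)
qed

lemma merge_spin_configs:
  "\<omega> \<in> spin_configs A \<Longrightarrow> \<zeta> \<in> spin_configs B \<Longrightarrow> merge A B (\<omega>, \<zeta>) \<in> spin_configs (A \<union> B)"
  unfolding spin_configs_def by (auto simp: PiE_iff merge_def extensional_def)

context mult_ising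
begin

text \<open>A volume reaching past twice \<open>\<Lambda>\<close> contains every interaction of \<open>\<Lambda>\<close> and keeps its boundary
  away from \<open>\<Lambda>\<close>, so \<open>D\<close> involves only the outer spins \<open>\<eta>\<close>.\<close>

lemma cyl_prob_merge:
  assumes \<Lambda>: "finite \<Lambda>" "\<Lambda> \<subseteq> {1..}" and n: "\<And>i. i \<in> \<Lambda> \<Longrightarrow> 2 * i < n" "Suc 0 \<le> n"
  shows "\<exists>D>0. \<forall>\<omega>. mult.cyl_prob n (merge \<Lambda> ({1..} - \<Lambda>) (\<omega>, \<eta>)) =
    D * exp (- gibbs_energy (mult_potential \<beta> J h) \<Lambda> \<omega> \<eta>)"
proof -
  obtain C where C: "C > 0" and cyl: "\<And>\<sigma>. mult.cyl_prob n \<sigma> =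
      C * (exp (mult.energy n \<sigma>) * (\<Prod>i\<in>mult.bd n. eigvec (\<sigma> i)))"
    using mult.cyl_prob_eq_energy[OF n(2)] by blast
  let ?V = "{Suc 0..<n}" and ?P = "{i \<in> {Suc 0..<n}. 2 * i < n}"
  let ?m = "\<lambda>\<omega>. merge \<Lambda> ({1..} - \<Lambda>) (\<omega>, \<eta>)"
  have sub: "\<Lambda> \<subseteq> ?V" "touching \<Lambda> \<subseteq> ?P"
    using \<Lambda>(2) n(1) by (force simp: touching_def)+
  have out: "?m \<omega> i = \<eta> i" if "i \<in> {1..} - \<Lambda>" for \<omega> i
    using that by (simp add: merge_def)
  define R where "R = (\<Sum>i\<in>?V - \<Lambda>. \<beta> * h * \<eta> i) + (\<Sum>i\<in>?P - touching \<Lambda>. \<beta> * J * \<eta> i * \<eta> (2 * i))"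
  have energy: "mult.energy n (?m \<omega>) = R - gibbs_energy (mult_potential \<beta> J h) \<Lambda> \<omega> \<eta>" for \<omega>
  proof -
    have "(\<Sum>i\<in>?V. \<beta> * h * ?m \<omega> i) = (\<Sum>i\<in>?V - \<Lambda>. \<beta> * h * \<eta> i) + (\<Sum>i\<in>\<Lambda>. \<beta> * h * ?m \<omega> i)"
      using sub by (subst sum.subset_diff[OF sub(1)]) (auto simp: out intro!: sum.cong)
    moreover have "(\<Sum>i\<in>?P. \<beta> * J * ?m \<omega> i * ?m \<omega> (2 * i)) =
        (\<Sum>i\<in>?P - touching \<Lambda>. \<beta> * J * \<eta> i * \<eta> (2 * i)) +
        (\<Sum>i\<in>touching \<Lambda>. \<beta> * J * ?m \<omega> i * ?m \<omega> (2 * i))"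
      using sub by (subst sum.subset_diff[OF sub(2)]) (auto simp: out touching_def intro!: sum.cong)
    ultimately show ?thesis
      unfolding mult.energy_def gibbs_energy_mult_potential[OF \<Lambda> refl] R_def by simp
  qed
  \<comment> \<open>A boundary site satisfies \<open>n \<le> 2 * i\<close> and so is not in
    \<Lambda>.\<close>
  have prod: "(\<Prod>i\<in>mult.bd n. eigvec (?m \<omega> i)) = (\<Prod>i\<in>mult.bd n. eigvec (\<eta> i))" for \<omega>
    using n(1) by (intro prod.cong refl arg_cong[where f = eigvec] out) (force simp: mult.bd_def)
  have "mult.cyl_prob n (?m \<omega>) = (C * exp R * (\<Prod>i\<in>mult.bd n. eigvec (\<eta> i))) *
      exp (- gibbs_energy (mult_potential \<beta> J h) \<Lambda> \<omega> \<eta>)" for \<omega>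
    unfolding cyl energy prod by (simp add: exp_diff exp_minus divide_inverse)
  then show ?thesis
    using C eigvec_pos
    by (intro exI[of _ "C * exp R * (\<Prod>i\<in>mult.bd n. eigvec (\<eta> i))"]) (auto intro!: mult_pos_pos prod_pos)
qed

text \<open>The factor from the outer spins cancels on normalising. In any sufficiently large volume
  the kernel is thus an elementary conditional probability under \<open>mult.gibbs\<close>.\<close>

lemma gibbs_kernel_eq_cyl_prob:
  assumes \<Lambda>: "finite \<Lambda>" "\<Lambda> \<subseteq> {1..}" and n: "\<And>i. i \<in> \<Lambda> \<Longrightarrow> 2 * i < n" "Suc 0 \<le> n"
  shows "gibbs_kernel (mult_potential \<beta> J h) \<Lambda> \<omega> \<eta> =
    mult.cyl_prob n (merge \<Lambda> ({1..} - \<Lambda>) (\<omega>, \<eta>)) /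
    (\<Sum>\<omega>'\<in>spin_configs \<Lambda>. mult.cyl_prob n (merge \<Lambda> ({1..} - \<Lambda>) (\<omega>', \<eta>)))"
proof -
  obtain D where D: "D > 0" and *: "\<And>\<omega>. mult.cyl_prob n (merge \<Lambda> ({1..} - \<Lambda>) (\<omega>, \<eta>)) =
      D * exp (- gibbs_energy (mult_potential \<beta> J h) \<Lambda> \<omega> \<eta>)"
    using cyl_prob_merge[OF \<Lambda> n] by blast
  show ?thesis
    unfolding * gibbs_kernel_def sum_distrib_left[symmetric] using D by simp
qed

text \<open>The indicator of the inner event and the kernel must have equal integrals over every
  outer event. Both integrals are measures in the outer event, so after transport to outer
  configurations it suffices to compare them on atoms of large windows.\<close>

lemma is_gibbs_measure_mult: "is_gibbs_measure (mult_potential \<beta> J h) mult.gibbs"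
  unfolding is_gibbs_measure_def
proof (intro conjI allI impI)
  interpret G: prob_space mult.gibbs by (rule mult.prob_space_gibbs)
  show "prob_space mult.gibbs" by (rule mult.prob_space_gibbs)
  show sets: "sets mult.gibbs = sets (spin_algebra {1..})"
    by (simp add: mult.sets_gibbs)
  have space: "space mult.gibbs = spin_configs {1..}"
    by (simp add: mult.space_gibbs)
  fix \<Lambda> :: "nat set" and \<omega> :: "nat \<Rightarrow> real"
  assume "finite \<Lambda> \<and> \<Lambda> \<subseteq> {1..} \<and> \<omega> \<in> spin_configs \<Lambda>"
  then have \<Lambda>: "finite \<Lambda>" "\<Lambda> \<subseteq> {1..}" and \<omega>: "\<omega> \<in> spin_configs \<Lambda>"
    by auto
  let ?F = "{\<sigma> \<in> space mult.gibbs. restrict \<sigma> \<Lambda> = \<omega>}"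
  let ?ker = "gibbs_kernel (mult_potential \<beta> J h) \<Lambda> \<omega>"
  let ?I = "{1..} - \<Lambda>"
  let ?res = "\<lambda>\<sigma>. restrict \<sigma> ?I"
  interpret S: finite_measure_subalgebra mult.gibbs "outside_algebra \<Lambda>"
    using subalgebra_outside_algebra[OF sets] by unfold_locales
  have F: "?F \<in> sets mult.gibbs"
    by (rule cylinder_measurable_singleton[OF sets \<Lambda> \<omega>])
  have f_meas: "indicator ?F \<in> borel_measurable mult.gibbs"
    using F by simp
  have ker_out: "?ker \<in> borel_measurable (outside_algebra \<Lambda>)"
    by (rule gibbs_kernel_measurable[OF \<Lambda>])
  then have ker_meas: "?ker \<in> borel_measurable mult.gibbs"
    by (rule measurable_from_subalg[OF S.subalg])
  note ker_bounds = gibbs_kernel_bounds[OF \<Lambda>(1) \<omega>, of "mult_potential \<beta> J h"]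
  have res: "?res \<in> measurable mult.gibbs (spin_algebra ?I)"
    using measurable_restrict_spin[of ?I "{1..}"] sets by (simp cong: measurable_cong_sets)
  define \<nu> where "\<nu> k = distr (density mult.gibbs (\<lambda>x. ennreal (k x))) (spin_algebra ?I) ?res"
    for k :: "(nat \<Rightarrow> real) \<Rightarrow> real"
  have \<nu>: "emeasure (\<nu> k) B = (\<integral>\<^sup>+x. ennreal (k x) * indicator (?res -` B \<inter> space mult.gibbs) x \<partial>mult.gibbs)"
    if "k \<in> borel_measurable mult.gibbs" "B \<in> sets (spin_algebra ?I)" for k B
    unfolding \<nu>_def using that res measurable_sets[OF res that(2)]
    by (subst emeasure_distr) (auto simp: emeasure_density)
  have space_\<nu>: "space (\<nu> k) = space (spin_algebra ?I)" for k
    by (simp add: \<nu>_def)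
  have \<nu>_eq: "\<nu> (indicator ?F) = \<nu> ?ker"
  \<comment> \<open>The sum over \<Lambda> dominates each of its members, so beyond this threshold
    the window reaches past twice every site of \<Lambda>.\<close>
  proof (rule spin_measure_eqI[where I = ?I and ?n0.0 = "Suc (2 * (\<Sum>i\<in>\<Lambda>. i))"])
    show "sets (\<nu> (indicator ?F)) = sets (spin_algebra ?I)" "sets (\<nu> ?ker) = sets (spin_algebra ?I)"
      by (simp_all add: \<nu>_def)
    have "emeasure (\<nu> (indicator ?F)) (space (spin_algebra ?I)) \<le> (\<integral>\<^sup>+x. 1 \<partial>mult.gibbs)"
      unfolding \<nu>[OF f_meas sets.top] by (intro nn_integral_mono) (auto split: split_indicator)
    then show "finite_measure (\<nu> (indicator ?F))"
      by (intro finite_measureI) (auto simp: \<nu>_def G.emeasure_space_1 top_unique)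
    fix n \<zeta> assume n: "Suc (2 * (\<Sum>i\<in>\<Lambda>. i)) \<le> n" and \<zeta>: "\<zeta> \<in> spin_configs (?I \<inter> {..<n})"
    define O' where "O' = ?I \<inter> {..<n}"
    have small: "2 * i < n" if "i \<in> \<Lambda>" for i
      using n member_le_sum[of i \<Lambda> "\<lambda>i. i"] \<Lambda>(1) that by simp
    have n1: "Suc 0 \<le> n" using n by simp
    have V: "\<Lambda> \<union> O' = {Suc 0..<n}" and disj: "\<Lambda> \<inter> O' = {}" and O': "finite O'" "O' \<subseteq> {1..}" "O' \<subseteq> ?I"
      using \<Lambda>(2) small by (force simp: O'_def)+
    have \<zeta>: "\<zeta> \<in> spin_configs O'" using \<zeta> by (simp add: O'_def)
    define p where "p \<omega>' = mult.cyl_prob n (merge \<Lambda> O' (\<omega>', \<zeta>))" for \<omega>'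
    have p_pos: "p \<omega>' > 0" for \<omega>'
      by (simp add: p_def mult.cyl_prob_pos)
    let ?S = "{\<sigma> \<in> space mult.gibbs. restrict \<sigma> O' = \<zeta>}"
    have S: "?S \<in> sets mult.gibbs"
      by (rule cylinder_measurable_singleton[OF sets O'(1,2) \<zeta>])
    have joint: "emeasure mult.gibbs {\<sigma> \<in> space mult.gibbs. restrict \<sigma> \<Lambda> = \<omega>' \<and> restrict \<sigma> O' = \<zeta>} = ennreal (p \<omega>')"
      if "\<omega>' \<in> spin_configs \<Lambda>" for \<omega>'
      using mult.measure_gibbs_cylinder[of "merge \<Lambda> O' (\<omega>', \<zeta>)" n] merge_spin_configs[OF that \<zeta>]
      unfolding restrict_eq_merge_iff[OF that \<zeta> disj] V p_def by (simp add: G.emeasure_eq_measure)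
    have "emeasure mult.gibbs ?S = emeasure mult.gibbs
        (\<Union>\<omega>'\<in>spin_configs \<Lambda>. {\<sigma> \<in> space mult.gibbs. restrict \<sigma> \<Lambda> = \<omega>' \<and> restrict \<sigma> O' = \<zeta>})"
      using \<Lambda>(2) by (intro arg_cong[where f = "emeasure mult.gibbs"])
        (auto simp: space intro: restrict_spin_configs)
    also have "\<dots> = (\<Sum>\<omega>'\<in>spin_configs \<Lambda>.
        emeasure mult.gibbs {\<sigma> \<in> space mult.gibbs. restrict \<sigma> \<Lambda> = \<omega>' \<and> restrict \<sigma> O' = \<zeta>})"
    proof (rule sum_emeasure[symmetric])
      show "finite (spin_configs \<Lambda>)" by (rule finite_spin_configs[OF \<Lambda>(1)])
      show "disjoint_family_on (\<lambda>\<omega>'. {\<sigma> \<in> space mult.gibbs. restrict \<sigma> \<Lambda> = \<omega>' \<and> restrict \<sigma> O' = \<zeta>}) (spin_configs \<Lambda>)"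
        by (auto simp: disjoint_family_on_def)
      have "{\<sigma> \<in> space mult.gibbs. restrict \<sigma> \<Lambda> = \<omega>' \<and> restrict \<sigma> O' = \<zeta>} \<in> sets mult.gibbs"
        if "\<omega>' \<in> spin_configs \<Lambda>" for \<omega>'
        using sets.Int[OF cylinder_measurable_singleton[OF sets \<Lambda> that] S]
        by (simp add: Int_def conj_ac cong: conj_cong)
      then show "(\<lambda>\<omega>'. {\<sigma> \<in> space mult.gibbs. restrict \<sigma> \<Lambda> = \<omega>' \<and> restrict \<sigma> O' = \<zeta>}) ` spin_configs \<Lambda> \<subseteq> sets mult.gibbs"
        by blast
    qed
    also have "\<dots> = ennreal (\<Sum>\<omega>'\<in>spin_configs \<Lambda>. p \<omega>')"
      using p_pos by (simp add: joint sum_ennreal less_imp_le)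
    finally have emS: "emeasure mult.gibbs ?S = ennreal (\<Sum>\<omega>'\<in>spin_configs \<Lambda>. p \<omega>')" .
    have Z: "(\<Sum>\<omega>'\<in>spin_configs \<Lambda>. p \<omega>') > 0"
      using \<omega> by (intro sum_pos finite_spin_configs \<Lambda> p_pos) auto
    \<comment> \<open>On an atom of the outer window the kernel is constant, since it reads only
      outer spins within the window.\<close>
    have ker_S: "?ker \<sigma> = p \<omega> / (\<Sum>\<omega>'\<in>spin_configs \<Lambda>. p \<omega>')" if "\<sigma> \<in> ?S" for \<sigma>
    proof -
      have "mult.cyl_prob n (merge \<Lambda> ?I (\<omega>', \<sigma>)) = p \<omega>'" for \<omega>'
        unfolding p_def
      proof (rule mult.cyl_prob_cong)
        fix i assume i: "i \<in> {Suc 0..<n}"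
        have "\<zeta> i = \<sigma> i" if "i \<in> O'"
          using \<open>\<sigma> \<in> ?S\<close> that by auto
        then show "merge \<Lambda> ?I (\<omega>', \<sigma>) i = merge \<Lambda> O' (\<omega>', \<zeta>) i"
          using i by (auto simp: merge_def O'_def)
      qed
      then show ?thesis
        by (subst gibbs_kernel_eq_cyl_prob[OF \<Lambda> small n1]) auto
    qed
    let ?B = "{\<tau> \<in> space (spin_algebra ?I). restrict \<tau> O' = \<zeta>}"
    have B: "?B \<in> sets (spin_algebra ?I)"
      by (rule cylinder_measurable_singleton[OF refl O'(1,3) \<zeta>])
    have pre: "?res -` ?B \<inter> space mult.gibbs = ?S"
      using O'(3) measurable_space[OF res] by (auto simp: Int_absorb1)
    have "emeasure (\<nu> (indicator ?F)) ?B = (\<integral>\<^sup>+x. indicator (?F \<inter> ?S) x \<partial>mult.gibbs)"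
      unfolding \<nu>[OF f_meas B] pre by (intro nn_integral_cong) (auto split: split_indicator)
    also have "\<dots> = emeasure mult.gibbs (?F \<inter> ?S)"
      using F S by (intro nn_integral_indicator) auto
    also have "?F \<inter> ?S = {\<sigma> \<in> space mult.gibbs. restrict \<sigma> \<Lambda> = \<omega> \<and> restrict \<sigma> O' = \<zeta>}"
      by blast
    also have "emeasure mult.gibbs \<dots> = ennreal (p \<omega>)"
      by (rule joint[OF \<omega>])
    also have "\<dots> = ennreal (p \<omega> / (\<Sum>\<omega>'\<in>spin_configs \<Lambda>. p \<omega>')) * emeasure mult.gibbs ?S"
      unfolding emS using Z p_pos[of \<omega>] by (simp add: ennreal_mult[symmetric])
    also have "\<dots> = (\<integral>\<^sup>+x. ennreal (p \<omega> / (\<Sum>\<omega>'\<in>spin_configs \<Lambda>. p \<omega>')) * indicator ?S x \<partial>mult.gibbs)"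
      using S by (simp add: nn_integral_cmult_indicator)
    also have "\<dots> = emeasure (\<nu> ?ker) ?B"
      unfolding \<nu>[OF ker_meas B] pre using ker_S by (intro nn_integral_cong) (auto split: split_indicator)
    finally show "emeasure (\<nu> (indicator ?F)) {\<tau> \<in> space (\<nu> (indicator ?F)). restrict \<tau> (?I \<inter> {..<n}) = \<zeta>} =
        emeasure (\<nu> ?ker) {\<tau> \<in> space (\<nu> ?ker). restrict \<tau> (?I \<inter> {..<n}) = \<zeta>}"
      unfolding space_\<nu> O'_def .
  qed
  show "AE \<eta> in mult.gibbs. real_cond_exp mult.gibbs (outside_algebra \<Lambda>) (indicator ?F) \<eta> = ?ker \<eta>"
  proof (rule S.real_cond_exp_charact)
    show "integrable mult.gibbs (indicator ?F :: _ \<Rightarrow> real)"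
      by (rule G.integrable_const_bound[where B = 1]) (use f_meas in auto)
    show "integrable mult.gibbs ?ker"
      by (rule G.integrable_const_bound[where B = 1]) (use ker_meas ker_bounds in auto)
    show "?ker \<in> borel_measurable (outside_algebra \<Lambda>)" by (rule ker_out)
    fix A assume "A \<in> sets (outside_algebra \<Lambda>)"
    then obtain B where B: "B \<in> sets (spin_algebra ?I)" and A: "A = ?res -` B \<inter> space mult.gibbs"
      unfolding outside_algebra_def
      by (subst (asm) sets_vimage_algebra2)
        (auto simp: space space_spin_algebra intro: restrict_spin_configs)
    have A_meas: "A \<in> sets mult.gibbs"
      unfolding A using measurable_sets[OF res B] .
    have SL: "set_lebesgue_integral mult.gibbs A k = enn2real (emeasure (\<nu> k) B)"
      if "k \<in> borel_measurable mult.gibbs" "\<And>x. 0 \<le> k x" for k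
    proof -
      have "set_lebesgue_integral mult.gibbs A k =
          enn2real (\<integral>\<^sup>+x. ennreal (indicator A x * k x) \<partial>mult.gibbs)"
        unfolding set_lebesgue_integral_def using that A_meas
        by (subst integral_eq_nn_integral) auto
      also have "(\<integral>\<^sup>+x. ennreal (indicator A x * k x) \<partial>mult.gibbs) = emeasure (\<nu> k) B"
        unfolding \<nu>[OF that(1) B] A by (intro nn_integral_cong) (auto split: split_indicator)
      finally show ?thesis .
    qed
    show "(LINT x:A|mult.gibbs. indicator ?F x) = (LINT x:A|mult.gibbs. ?ker x)"
      by (simp only: SL[OF f_meas indicator_pos_le] SL[OF ker_meas ker_bounds(1)] \<nu>_eq)
  qed
qed

section \<open>Uniqueness through finite-volume kernels\<close>

lemma gibbs_energy_volume:
  "gibbs_energy (mult_potential \<beta> J h) {1..2 * N} \<omega> \<eta> = mult_hamiltonian \<beta> J h N \<eta> \<omega>"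
proof -
  let ?m = "merge {1..2 * N} ({1..} - {1..2 * N}) (\<omega>, \<eta>)"
  \<comment> \<open>Bonds from 1 to N lie inside and those from N + 1 to 2N cross outwards; none
    enters from outside, as a lower endpoint is smaller.\<close>
  have t: "touching {1..2 * N} = {1..N + N}"
    by (auto simp: touching_def)
  have "(\<Sum>i=1..N + N. \<beta> * J * ?m i * ?m (2 * i)) =
      (\<Sum>i=1..N. \<beta> * J * ?m i * ?m (2 * i)) + (\<Sum>i=N + 1..N + N. \<beta> * J * ?m i * ?m (2 * i))"
    by (rule sum.ub_add_nat) simp
  also have "(\<Sum>i=1..N. \<beta> * J * ?m i * ?m (2 * i)) = (\<Sum>i=1..N. \<beta> * (J * \<omega> i * \<omega> (2 * i)))"
    by (intro sum.cong) (auto simp: merge_def)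
  also have "(\<Sum>i=N + 1..N + N. \<beta> * J * ?m i * ?m (2 * i)) = (\<Sum>i=N + 1..2 * N. \<beta> * (J * \<omega> i * \<eta> (2 * i)))"
    by (intro sum.cong) (auto simp: merge_def)
  finally have "(\<Sum>i\<in>touching {1..2 * N}. \<beta> * J * ?m i * ?m (2 * i)) =
      (\<Sum>i=1..N. \<beta> * (J * \<omega> i * \<omega> (2 * i))) + (\<Sum>i=N + 1..2 * N. \<beta> * (J * \<omega> i * \<eta> (2 * i)))"
    unfolding t .
  moreover have "(\<Sum>i=1..2 * N. \<beta> * h * ?m i) = (\<Sum>i=1..2 * N. \<beta> * (h * \<omega> i))"
    by (intro sum.cong) (auto simp: merge_def)
  moreover have "gibbs_energy (mult_potential \<beta> J h) {1..2 * N} \<omega> \<eta> =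
      - ((\<Sum>i=1..2 * N. \<beta> * h * ?m i) + (\<Sum>i\<in>touching {1..2 * N}. \<beta> * J * ?m i * ?m (2 * i)))"
    by (rule gibbs_energy_mult_potential) auto
  ultimately show ?thesis
    unfolding mult_hamiltonian_def by (simp only: sum_distrib_left[symmetric] distrib_left)
qed

text \<open>As a finite sum of kernels, the finite-volume probability is visibly measurable in the
  boundary condition and integrable under a Gibbs measure.\<close>

lemma measure_mult_ising_finite:
  "S \<subseteq> spin_configs {1..2 * N} \<Longrightarrow> measure (mult_ising_finite \<beta> J h N \<eta>) S =
    (\<Sum>\<omega>\<in>S. gibbs_kernel (mult_potential \<beta> J h) {1..2 * N} \<omega> \<eta>)"
  unfolding mult_ising_finite_def gibbs_kernel_def gibbs_energy_volume
  by (simp add: measure_boltzmann_measure sum_divide_distrib)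

text \<open>Averaging the finite-volume window probability over \<mu> gives the \<mu>-probability of
  the window as soon as the volume contains it, while the integrand tends to a constant for every
  boundary condition.\<close>

lemma gibbs_measure_unique:
  assumes gibbs: "is_gibbs_measure (mult_potential \<beta> J h) \<mu>"
  shows "\<mu> = mult.gibbs"
proof (rule spin_measure_eqI[where I = "{1..}" and ?n0.0 = 1])
  have "prob_space \<mu>" and sets: "sets \<mu> = sets (spin_algebra {1..})"
    using gibbs by (auto simp: is_gibbs_measure_def)
  interpret P: prob_space \<mu> by fact
  interpret G: prob_space mult.gibbs by (rule mult.prob_space_gibbs)
  show "sets \<mu> = sets (spin_algebra {1..})" "sets mult.gibbs = sets (spin_algebra {1..})"
    "finite_measure \<mu>"
    by (simp_all add: sets mult.sets_gibbs P.finite_measure_axioms)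
  have space: "space \<mu> = spin_configs {1..}"
    using sets_eq_imp_space_eq[OF sets] by (simp add: space_spin_algebra)
  fix m \<zeta> assume m: "1 \<le> m" and "\<zeta> \<in> spin_configs ({1..} \<inter> {..<m})"
  moreover have ivl: "{1..} \<inter> {..<m} = {Suc 0..<m}" by auto
  ultimately have \<zeta>: "\<zeta> \<in> spin_configs {Suc 0..<m}" by simp
  let ?Q = "\<lambda>N \<eta>. measure (mult_ising_finite \<beta> J h N \<eta>) {\<omega> \<in> spin_configs {1..2 * N}. restrict \<omega> {Suc 0..<m} = \<zeta>}"
  have ker_meas: "gibbs_kernel (mult_potential \<beta> J h) {1..2 * N} \<omega> \<in> borel_measurable \<mu>" for N \<omega>
    by (rule measurable_from_subalg[OF subalgebra_outside_algebra[OF sets] gibbs_kernel_measurable]) auto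
  have ker_int: "integrable \<mu> (gibbs_kernel (mult_potential \<beta> J h) {1..2 * N} \<omega>)"
    if "\<omega> \<in> spin_configs {1..2 * N}" for N \<omega>
    by (rule P.integrable_const_bound[where B = 1])
      (use ker_meas gibbs_kernel_bounds[OF _ that] in auto)
  \<comment> \<open>Taking the expectation of the conditional probability removes the
    conditioning.\<close>
  have dlr: "measure \<mu> {\<sigma> \<in> space \<mu>. restrict \<sigma> {1..2 * N} = \<omega>} =
      (\<integral>\<eta>. gibbs_kernel (mult_potential \<beta> J h) {1..2 * N} \<omega> \<eta> \<partial>\<mu>)"
    if \<omega>: "\<omega> \<in> spin_configs {1..2 * N}" for N \<omega>
  proof -
    let ?F = "{\<sigma> \<in> space \<mu>. restrict \<sigma> {1..2 * N} = \<omega>}"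
    interpret S: finite_measure_subalgebra \<mu> "outside_algebra {1..2 * N}"
      using subalgebra_outside_algebra[OF sets] by unfold_locales
    have F: "?F \<in> sets \<mu>"
      by (rule cylinder_measurable_singleton[OF sets _ _ \<omega>]) auto
    then have int: "integrable \<mu> (indicator ?F :: _ \<Rightarrow> real)"
      by (intro P.integrable_const_bound[where B = 1]) auto
    have "measure \<mu> ?F = (\<integral>\<eta>. real_cond_exp \<mu> (outside_algebra {1..2 * N}) (indicator ?F) \<eta> \<partial>\<mu>)"
      using S.real_cond_exp_int(2)[OF int] F by simp
    also have "\<dots> = (\<integral>\<eta>. gibbs_kernel (mult_potential \<beta> J h) {1..2 * N} \<omega> \<eta> \<partial>\<mu>)"
      using gibbs \<omega> ker_meas S.real_cond_exp_int(1)[OF int]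
      by (intro integral_cong_AE) (auto simp: is_gibbs_measure_def)
    finally show ?thesis .
  qed
  have "(\<lambda>N. \<integral>\<eta>. ?Q N \<eta> \<partial>\<mu>) \<longlonglongrightarrow> (\<integral>\<eta>. mult.cyl_prob m \<zeta> \<partial>\<mu>)"
  proof (rule integral_dominated_convergence[where w = "\<lambda>_. 1"])
    show "AE \<eta> in \<mu>. (\<lambda>N. ?Q N \<eta>) \<longlonglongrightarrow> mult.cyl_prob m \<zeta>"
      using m \<zeta> by (intro AE_I2 mult_cylinder_tendsto) (auto simp: space)
    show "AE \<eta> in \<mu>. norm (?Q N \<eta>) \<le> 1" for N
    proof (rule AE_I2)
      fix \<eta>
      interpret B: prob_space "mult_ising_finite \<beta> J h N \<eta>"
        unfolding mult_ising_finite_def by (rule prob_space_boltzmann_measure) simp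
      show "norm (?Q N \<eta>) \<le> 1" by simp
    qed
    show "?Q N \<in> borel_measurable \<mu>" for N
      using ker_meas by (subst measure_mult_ising_finite) auto
  qed simp_all
  then have lim: "(\<lambda>N. \<integral>\<eta>. ?Q N \<eta> \<partial>\<mu>) \<longlonglongrightarrow> mult.cyl_prob m \<zeta>"
    by (simp add: P.prob_space)
  have "(\<integral>\<eta>. ?Q N \<eta> \<partial>\<mu>) = measure \<mu> {\<sigma> \<in> space \<mu>. restrict \<sigma> {Suc 0..<m} = \<zeta>}" if N: "m \<le> N" for N
  proof -
    let ?T = "{\<omega> \<in> spin_configs {1..2 * N}. restrict \<omega> {Suc 0..<m} = \<zeta>}"
    have "(\<integral>\<eta>. ?Q N \<eta> \<partial>\<mu>) = (\<integral>\<eta>. (\<Sum>\<omega>\<in>?T. gibbs_kernel (mult_potential \<beta> J h) {1..2 * N} \<omega> \<eta>) \<partial>\<mu>)"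
      by (subst measure_mult_ising_finite) auto
    also have "\<dots> = (\<Sum>\<omega>\<in>?T. \<integral>\<eta>. gibbs_kernel (mult_potential \<beta> J h) {1..2 * N} \<omega> \<eta> \<partial>\<mu>)"
      by (rule Bochner_Integration.integral_sum, rule ker_int) simp
    also have "\<dots> = (\<Sum>\<omega>\<in>?T. measure \<mu> {\<sigma> \<in> space \<mu>. restrict \<sigma> {1..2 * N} = \<omega>})"
      by (intro sum.cong refl dlr[symmetric]) simp
    also have "\<dots> = measure \<mu> {\<sigma> \<in> space \<mu>. restrict \<sigma> {Suc 0..<m} \<in> {\<zeta>}}"
      using N \<zeta> by (subst measure_cylinder_eq_sum[OF P.finite_measure_axioms sets, of "{1..2 * N}"]) auto
    finally show ?thesis by simp
  qed
  then have "eventually (\<lambda>N. (\<integral>\<eta>. ?Q N \<eta> \<partial>\<mu>) = measure \<mu> {\<sigma> \<in> space \<mu>. restrict \<sigma> {Suc 0..<m} = \<zeta>}) sequentially"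
    by (auto simp: eventually_sequentially)
  from Lim_transform_eventually[OF lim this]
  have "measure \<mu> {\<sigma> \<in> space \<mu>. restrict \<sigma> {Suc 0..<m} = \<zeta>} = mult.cyl_prob m \<zeta>"
    by (simp add: LIMSEQ_const_iff)
  then show "emeasure \<mu> {\<sigma> \<in> space \<mu>. restrict \<sigma> ({1..} \<inter> {..<m}) = \<zeta>} =
      emeasure mult.gibbs {\<sigma> \<in> space mult.gibbs. restrict \<sigma> ({1..} \<inter> {..<m}) = \<zeta>}"
    using mult.measure_gibbs_cylinder[OF \<zeta>] unfolding ivl
    by (simp add: P.emeasure_eq_measure G.emeasure_eq_measure)
qed

end

theorem theorem3p2:
  fixes \<beta> J h :: real
  assumes "\<beta> > 0"
  shows "\<exists>\<mu> \<nu>.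
    (\<forall>\<eta>\<in>spin_configs {1..}. cylinder_limit {1..} (\<lambda>N. mult_ising_finite \<beta> J h N \<eta>) \<mu>) \<and>
    is_gibbs_measure (mult_potential \<beta> J h) \<mu> \<and>
    (\<forall>\<mu>'. is_gibbs_measure (mult_potential \<beta> J h) \<mu>' \<longrightarrow> \<mu>' = \<mu>) \<and>
    is_standard_ising \<beta> J h \<nu> \<and>
    prob_space.indep_vars \<mu> (\<lambda>_. spin_algebra UNIV) layer {r. odd r} \<and>
    (\<forall>r. odd r \<longrightarrow> distr \<mu> (spin_algebra UNIV) (layer r) = \<nu>) \<and>
    (h = 0 \<longrightarrow> (\<forall>i\<ge>1. distr \<mu> (spin_algebra {1..}) (mult_shift i) = \<mu>))"
proof -
  \<comment> \<open>The weights depend on the parameters only through these two products, so one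
    kernel drives both the chain and the multiplicative model.\<close>
  obtain t lam where "ising_kernel (\<beta> * J) (\<beta> * h) t lam"
    using ex_ising_kernel by blast
  then interpret mult_ising \<beta> J h t lam
    by (simp add: mult_ising_def)
  show ?thesis
    unfolding One_nat_def
  proof (intro exI conjI ballI allI impI)
    show "cylinder_limit {Suc 0..} (\<lambda>N. mult_ising_finite \<beta> J h N \<eta>) mult.gibbs"
      if "\<eta> \<in> spin_configs {Suc 0..}" for \<eta>
      using that cylinder_limit_mult by simp
    show "distr mult.gibbs (spin_algebra {Suc 0..}) (mult_shift i) = mult.gibbs" if "h = 0" "i \<ge> Suc 0" for i
      using that by (intro distr_mult_shift) simp_all
  qed (fact is_gibbs_measure_mult indep_vars_layers | erule gibbs_measure_unique
      | rule is_standard_ising_line | erule distr_layer)+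
qed

end
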